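(* Let $X_{3,3}\subset\mathbb{P}^5$ be a threefold that is a complete intersection of two cubic hypersurfaces and that has only ordinary triple points as singularities. Assume furthermore that for every triple point $O_i$ of $X_{3,3}$ there exists a cubic fourfold $X_i\subset\mathbb{P}^5$ containing $X_{3,3}$ such that $O_i$ is a triple point of $X_i$. Then $X_{3,3}$ has at most $9$ ordinary triple points.
   Context: All varieties are over $\mathbb{C}$. An ordinary triple point on a threefold $X$ is an isolated singularity $O$ of $X$ such that the tangent cone to $X$ at $O$ is a cone over a smooth surface of degree three (a smooth cubic surface in $\mathbb{P}^3$). A cubic fourfold is a hypersurface of degree $3$ in $\mathbb{P}^5$; a point is a triple point of such a hypersurface if the hypersurface has multiplicity $3$ there, i.e. the defining polynomial and all its partial derivatives of order at most $2$ vanish at the point. If $X_{3,3}=V(F_3,G_3)$, the cubic fourfolds containing $X_{3,3}$ are the members $V(\alpha F_3+\beta G_3)$, $(\alpha,\beta)\in\mathbb{C}^2\setminus\{0\}$, of a pencil. *)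

theory Defs
  imports "HOL-Analysis.Analysis" "HOL-Library.Poly_Mapping"
begin

section \<open>Polynomials over the complex numbers in finitely many variables\<close>

text \<open>
  The variables are indexed by a finite type \<open>'n\<close>; a monomial is its exponent
  vector, of type \<open>'n \<Rightarrow>\<^sub>0 nat\<close>.
\<close>

type_synonym 'n mpoly = "('n \<Rightarrow>\<^sub>0 nat) \<Rightarrow>\<^sub>0 complex"

abbreviation Const :: "complex \<Rightarrow> 'n mpoly" where
  "Const c \<equiv> Poly_Mapping.single 0 c"

abbreviation Var :: "'n \<Rightarrow> 'n mpoly" where
  "Var j \<equiv> Poly_Mapping.single (Poly_Mapping.single j 1) 1"

definition peval :: "'n::finite mpoly \<Rightarrow> complex ^ 'n \<Rightarrow> complex" where
  "peval p v = (\<Sum>m\<in>Poly_Mapping.keys p.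
      Poly_Mapping.lookup p m * (\<Prod>j\<in>UNIV. (v $ j) ^ Poly_Mapping.lookup m j))"

definition psubst :: "('n \<Rightarrow> 'm mpoly) \<Rightarrow> 'n::finite mpoly \<Rightarrow> 'm mpoly" where
  "psubst s p = (\<Sum>m\<in>Poly_Mapping.keys p.
      Const (Poly_Mapping.lookup p m) * (\<Prod>j\<in>UNIV. s j ^ Poly_Mapping.lookup m j))"

text \<open>
  Formal partial derivative. The truncated subtraction of exponents is harmless:
  it only truncates in terms whose coefficient is multiplied by 0.
\<close>

definition pdiff :: "'n \<Rightarrow> 'n mpoly \<Rightarrow> 'n mpoly" where
  "pdiff j p = (\<Sum>m\<in>Poly_Mapping.keys p.
      Poly_Mapping.single (m - Poly_Mapping.single j 1)
        (of_nat (Poly_Mapping.lookup m j) * Poly_Mapping.lookup p m))"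

definition gradient :: "'n::finite mpoly \<Rightarrow> complex ^ 'n \<Rightarrow> complex ^ 'n" where
  "gradient p v = (\<chi> j. peval (pdiff j p) v)"

definition monom_degree :: "('n::finite \<Rightarrow>\<^sub>0 nat) \<Rightarrow> nat" where
  "monom_degree m = (\<Sum>j\<in>UNIV. Poly_Mapping.lookup m j)"

definition homogeneous :: "nat \<Rightarrow> 'n::finite mpoly \<Rightarrow> bool" where
  "homogeneous d p \<longleftrightarrow> (\<forall>m\<in>Poly_Mapping.keys p. monom_degree m = d)"

definition cubic_form :: "'n::finite mpoly \<Rightarrow> bool" where
  "cubic_form p \<longleftrightarrow> p \<noteq> 0 \<and> homogeneous 3 p"

text \<open>The ideal generated by a set is its span in the ring as a module over itself.\<close>

abbreviation ideal_gen :: "'n mpoly set \<Rightarrow> 'n mpoly set" where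
  "ideal_gen S \<equiv> module.span (*) S"

section \<open>Projective algebraic sets\<close>

text \<open>
  A point of the projective space with homogeneous coordinates indexed by \<open>'n\<close>
  (dimension \<open>CARD('n) - 1\<close>) is a line through the origin in \<open>complex ^ 'n\<close>.
\<close>

type_synonym 'n ppoint = "(complex ^ 'n) set"

definition proj_space :: "'n::finite ppoint set" where
  "proj_space = {vec.span {v} |v. v \<noteq> 0}"

definition zero_locus :: "'n::finite mpoly set \<Rightarrow> 'n ppoint set" where
  "zero_locus S = {P \<in> proj_space. \<forall>p\<in>S. \<forall>v\<in>P. peval p v = 0}"

definition zariski_closed :: "'n::finite ppoint set \<Rightarrow> bool" where
  "zariski_closed X \<longleftrightarrow> (\<exists>S. (\<forall>p\<in>S. \<exists>d. homogeneous d p) \<and> X = zero_locus S)"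

definition irreducible_closed :: "'n::finite ppoint set \<Rightarrow> bool" where
  "irreducible_closed X \<longleftrightarrow> zariski_closed X \<and> X \<noteq> {} \<and>
     (\<forall>A B. zariski_closed A \<and> zariski_closed B \<and> X \<subseteq> A \<union> B \<longrightarrow> X \<subseteq> A \<or> X \<subseteq> B)"

text \<open>Krull dimension: the supremum of lengths of chains of irreducible closed subsets.\<close>

definition zariski_dim :: "'n::finite ppoint set \<Rightarrow> enat" where
  "zariski_dim X = Sup {enat k |k. \<exists>Z.
     (\<forall>i\<le>k. irreducible_closed (Z i) \<and> Z i \<subseteq> X) \<and> (\<forall>i<k. Z i \<subset> Z (Suc i))}"

definition threefold :: "'n::finite ppoint set \<Rightarrow> bool" where
  "threefold X \<longleftrightarrow> irreducible_closed X \<and> zariski_dim X = 3"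

text \<open>
  The homogeneous ideal of \<open>X\<close>. As a point is a whole line, every homogeneous
  component of a member of this set is again a member.
\<close>

definition vanishing_ideal :: "'n::finite ppoint set \<Rightarrow> 'n mpoly set" where
  "vanishing_ideal X = {p. \<forall>P\<in>X. \<forall>v\<in>P. peval p v = 0}"

section \<open>Singularities\<close>

text \<open>
  Projective Jacobian criterion: \<open>X\<close> is nonsingular at a point iff the gradients of
  the members of its homogeneous ideal span a space of dimension the codimension of \<open>X\<close>.
\<close>

definition nonsingular_at :: "'n::finite ppoint set \<Rightarrow> 'n ppoint \<Rightarrow> bool" where
  "nonsingular_at X P \<longleftrightarrow> (\<forall>v\<in>P - {0}.
     enat (vec.dim {gradient h v |h. h \<in> vanishing_ideal X}) + zariski_dim X
       = enat (CARD('n) - 1))"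

definition singular_point :: "'n::finite ppoint set \<Rightarrow> 'n ppoint \<Rightarrow> bool" where
  "singular_point X P \<longleftrightarrow> P \<in> X \<and> \<not> nonsingular_at X P"

definition isolated_singular_point :: "'n::finite ppoint set \<Rightarrow> 'n ppoint \<Rightarrow> bool" where
  "isolated_singular_point X P \<longleftrightarrow> singular_point X P \<and>
     (\<exists>Z. zariski_closed Z \<and> P \<notin> Z \<and> (\<forall>Q. singular_point X Q \<and> Q \<notin> Z \<longrightarrow> Q = P))"

definition initial_form :: "'n::finite mpoly \<Rightarrow> 'n mpoly" where
  "initial_form p =
     (\<Sum>m\<in>{m \<in> Poly_Mapping.keys p. monom_degree m = Min (monom_degree ` Poly_Mapping.keys p)}.
        Poly_Mapping.single m (Poly_Mapping.lookup p m))"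

text \<open>
  The ideal of the (scheme-theoretic) tangent cone at the point \<open>v\<close> of the closed
  subscheme of affine space with ideal \<open>I\<close>, in coordinates centred at \<open>v\<close>.
  Passing to the local ring would not change it: units only contribute nonzero
  constant factors to initial forms.
\<close>

definition tangent_cone_ideal :: "'n::finite mpoly set \<Rightarrow> complex ^ 'n \<Rightarrow> 'n mpoly set" where
  "tangent_cone_ideal I v =
     ideal_gen {initial_form (psubst (\<lambda>j. Var j + Const (v $ j)) h) |h. h \<in> I}"

text \<open>
  The standard chart \<open>x\<^sub>i \<noteq> 0\<close> of projective space is identified with the affine
  hyperplane \<open>x\<^sub>i = 1\<close> of \<open>complex ^ 'n\<close>; this is the ideal of the part of \<open>X\<close> in
  that chart, as a subscheme of \<open>complex ^ 'n\<close>.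
\<close>

definition chart_ideal :: "'n::finite ppoint set \<Rightarrow> 'n \<Rightarrow> 'n mpoly set" where
  "chart_ideal X i = ideal_gen (insert (Var i - 1) (vanishing_ideal X))"

definition smooth_cubic_surface :: "4 mpoly \<Rightarrow> bool" where
  "smooth_cubic_surface c \<longleftrightarrow> cubic_form c \<and>
     (\<forall>z. z \<noteq> 0 \<and> peval c z = 0 \<longrightarrow> gradient c z \<noteq> 0)"

text \<open>
  \<open>J\<close> is the ideal of the cone over a smooth cubic surface \<open>c = 0\<close>, where the projective
  3-space of the surface is embedded linearly by the matrix \<open>A\<close>.
\<close>

definition cone_over_smooth_cubic_surface :: "'n::finite mpoly set \<Rightarrow> bool" where
  "cone_over_smooth_cubic_surface J \<longleftrightarrow> (\<exists>(A :: complex ^ 4 ^ 'n) c.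
     inj ((*v) A) \<and> smooth_cubic_surface c \<and>
     J = {p. c dvd psubst (\<lambda>i. \<Sum>j\<in>UNIV. Const (A $ i $ j) * Var j) p})"

definition ordinary_triple_point :: "'n::finite ppoint set \<Rightarrow> 'n ppoint \<Rightarrow> bool" where
  "ordinary_triple_point X P \<longleftrightarrow> isolated_singular_point X P \<and>
     (\<exists>i v. v \<in> P \<and> v $ i = 1 \<and>
        cone_over_smooth_cubic_surface (tangent_cone_ideal (chart_ideal X i) v))"

definition hypersurface_triple_point :: "'n::finite mpoly \<Rightarrow> 'n ppoint \<Rightarrow> bool" where
  "hypersurface_triple_point H P \<longleftrightarrow> P \<in> proj_space \<and>
     (\<forall>v\<in>P. peval H v = 0 \<and> (\<forall>j. peval (pdiff j H) v = 0) \<and>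
        (\<forall>j k. peval (pdiff j (pdiff k H)) v = 0))"

text \<open>
  Complete intersection in the ideal-theoretic sense: \<open>X\<close> has codimension 2 and its
  homogeneous ideal is generated by the two forms.
\<close>

definition complete_intersection_of_cubics ::
    "'n::finite ppoint set \<Rightarrow> 'n mpoly \<Rightarrow> 'n mpoly \<Rightarrow> bool" where
  "complete_intersection_of_cubics X F G \<longleftrightarrow>
     cubic_form F \<and> cubic_form G \<and> zariski_dim X + 2 = enat (CARD('n) - 1) \<and>
     vanishing_ideal X = ideal_gen {F, G}"

end

theory Submission
  imports Defs
begin

text \<open>
  A cubic form \<open>H\<close> with a triple point \<open>v\<close> defines a cone with vertex \<open>v\<close>: the symmetric
  trilinear form \<open>polar H\<close> of its third derivatives satisfies \<open>polar H v = 0\<close>. The vertices of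
  one cubic therefore form a linear space. Since a cubic containing \<open>X\<close> lies in the pencil
  spanned by \<open>F\<close> and \<open>G\<close>, every triple point of \<open>X\<close> is a vertex of some member of that pencil.

  Locally, let \<open>v\<close> be an ordinary triple point of \<open>X\<close> and a vertex of the member \<open>H\<close>. Some
  member is smooth at \<open>v\<close>, with the tangent hyperplane \<open>T\<close>: otherwise all 5 dimensions of
  directions at \<open>v\<close> would be tangent, but the tangent cone spans only 4 of them.
  Inside \<open>T\<close> the tangent cone is cut out by \<open>H\<close>, so \<open>H\<close> restricted to \<open>T\<close> is the cone over a
  smooth cubic surface, whose only vertex is \<open>v\<close>. Hence the vertex space of \<open>H\<close> meets \<open>T\<close> only in
  the line of \<open>v\<close>. This is \<open>ordinary_triple_point_of_pencil\<close>, with conclusion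
  \<open>transversal_vertex\<close>. The one degenerate case, \<open>H\<close> vanishing on \<open>T\<close>, would make \<open>H\<close> a product
  of a linear and a quadratic form, one of which would vanish on the irreducible \<open>X\<close> although its
  ideal starts in degree 3 (\<open>no_cubic_vanishing_on_hyperplane\<close>).

  Globally, if \<open>v\<close> and \<open>v'\<close> are vertices of two different members, then \<open>polar K v v' = 0\<close> for
  both of these members \<open>K\<close> and so for the whole pencil. Together with transversality this
  orthogonality makes the vertex spaces of the different members linearly independent
  (\<open>vertices_independent_scalars\<close>). By transversality again, the vertex space of one member is
  at most a projective line, and a further member restricts to that line as a nonzero binary
  cubic, so it carries at most three of the points (\<open>card_vertices_of_member\<close>). At least two
  thirds of the points can thus be chosen to be independent vectors in a space of dimension 6,
  which leaves room for at most 9 points.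
\<close>

section \<open>Evaluation of polynomials\<close>

lemma mpoly_eq_sum_single:
  fixes p :: "'n mpoly"
  shows "p = (\<Sum>m\<in>Poly_Mapping.keys p. Poly_Mapping.single m (Poly_Mapping.lookup p m))"
  by (rule poly_mapping_eqI) (auto simp: lookup_sum lookup_single when_def in_keys_iff)

lemma mpoly_induct [case_names single add]:
  fixes p :: "'n mpoly"
  assumes single: "\<And>m c. P (Poly_Mapping.single m c)"
    and add: "\<And>p q. P p \<Longrightarrow> P q \<Longrightarrow> P (p + q)"
  shows "P p"
proof -
  have "P (\<Sum>m\<in>K. Poly_Mapping.single m (Poly_Mapping.lookup p m))" if "finite K" for K
    using that
  proof (induction K rule: finite_induct)
    case empty
    show ?case using single[of 0 0] by simp
  qed (auto intro: single add)
  from this[of "Poly_Mapping.keys p"] show ?thesis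
    using mpoly_eq_sum_single[of p] by simp
qed

definition monom_eval :: "('n::finite \<Rightarrow>\<^sub>0 nat) \<Rightarrow> complex ^ 'n \<Rightarrow> complex" where
  "monom_eval m v = (\<Prod>j\<in>UNIV. (v $ j) ^ Poly_Mapping.lookup m j)"

lemma monom_eval_add: "monom_eval (m + m') v = monom_eval m v * monom_eval m' v"
  by (simp add: monom_eval_def lookup_add power_add prod.distrib)

lemma monom_eval_single: "monom_eval (Poly_Mapping.single j k) v = (v $ j) ^ k"
proof -
  have "monom_eval (Poly_Mapping.single j k) v = (\<Prod>i\<in>UNIV. if i = j then (v $ j) ^ k else 1)"
    unfolding monom_eval_def by (intro prod.cong) (auto simp: lookup_single when_def)
  then show ?thesis by simp
qed

lemma monom_eval_zero_exponent [simp]: "monom_eval 0 v = 1"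
  by (simp add: monom_eval_def)

lemma monom_eval_at_zero: "monom_eval m 0 = (if m = 0 then 1 else 0)"
proof (cases "m = 0")
  case False
  then obtain j where "Poly_Mapping.lookup m j \<noteq> 0"
    by (metis lookup_zero poly_mapping_eqI)
  then show ?thesis
    using False unfolding monom_eval_def by (auto simp: prod_zero_iff)
qed simp

lemma monom_eval_scale: "monom_eval m (t *s v) = t ^ monom_degree m * monom_eval m v"
  by (simp add: monom_eval_def monom_degree_def power_mult_distrib prod.distrib power_sum)

lemma peval_superset:
  assumes "finite K" "Poly_Mapping.keys p \<subseteq> K"
  shows "peval p v = (\<Sum>m\<in>K. Poly_Mapping.lookup p m * monom_eval m v)"
  unfolding peval_def monom_eval_def
  using assms by (intro sum.mono_neutral_left) (auto simp: in_keys_iff)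

lemma peval_eq_sum:
  "peval p v = (\<Sum>m\<in>Poly_Mapping.keys p. Poly_Mapping.lookup p m * monom_eval m v)"
  by (rule peval_superset) auto

lemma peval_zero [simp]: "peval 0 v = 0"
  by (simp add: peval_def)

lemma peval_add [simp]: "peval (p + q) v = peval p v + peval q v"
proof -
  let ?K = "Poly_Mapping.keys p \<union> Poly_Mapping.keys q"
  have "peval (p + q) v = (\<Sum>m\<in>?K. Poly_Mapping.lookup (p + q) m * monom_eval m v)"
    by (rule peval_superset) (use keys_add[of p q] in auto)
  also have "\<dots> = peval p v + peval q v"
    by (simp add: peval_superset[of ?K p] peval_superset[of ?K q] lookup_add ring_distribs
        sum.distrib)
  finally show ?thesis .
qed

lemma peval_single: "peval (Poly_Mapping.single m c) v = c * monom_eval m v"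
  by (subst peval_superset[of "{m}"]) auto

lemma peval_Const [simp]: "peval (Const c) v = c"
  by (simp add: peval_single)

lemma peval_Var [simp]: "peval (Var j) v = v $ j"
  by (simp add: peval_single monom_eval_single)

(* The simplifier rewrites the exponent 1 in Var to Suc 0, which hides the rule above. *)
lemmas [simp] = peval_Var[simplified]

lemma peval_one [simp]: "peval 1 v = 1"
  by (metis peval_Const single_one)

lemma peval_mult [simp]: "peval (p * q) v = peval p v * peval q v"
proof (induction p rule: mpoly_induct)
  case (single m c)
  show ?case
    by (induction q rule: mpoly_induct)
      (simp_all add: mult_single peval_single monom_eval_add ring_distribs)
qed (simp add: ring_distribs)

lemma peval_uminus [simp]: "peval (- p) v = - peval p v"
  using peval_add[of p "- p" v] by (simp add: eq_neg_iff_add_eq_0 add.commute)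

lemma peval_diff [simp]: "peval (p - q) v = peval p v - peval q v"
  using peval_add[of p "- q" v] by simp

lemma peval_sum [simp]: "peval (\<Sum>i\<in>I. f i) v = (\<Sum>i\<in>I. peval (f i) v)"
  by (induction I rule: infinite_finite_induct) auto

lemma peval_prod [simp]: "peval (\<Prod>i\<in>I. f i) v = (\<Prod>i\<in>I. peval (f i) v)"
  by (induction I rule: infinite_finite_induct) auto

lemma peval_power [simp]: "peval (p ^ k) v = peval p v ^ k"
  by (induction k) auto

lemma peval_psubst [simp]: "peval (psubst s p) y = peval p (\<chi> j. peval (s j) y)"
  by (simp add: psubst_def peval_def[of p])

lemma peval_at_zero: "peval p 0 = Poly_Mapping.lookup p 0"
proof -
  have "peval p 0 = (\<Sum>m\<in>Poly_Mapping.keys p. if m = 0 then Poly_Mapping.lookup p m else 0)"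
    unfolding peval_eq_sum by (intro sum.cong) (auto simp: monom_eval_at_zero)
  then show ?thesis by (auto simp: in_keys_iff)
qed

text \<open>
  Letting \<open>t\<close> tend to 0 in an identity between values at \<open>t *s v\<close> isolates its part of lowest
  degree. This replaces degree arguments for products in the polynomial ring.
\<close>
lemma tendsto_peval_scale: "(\<lambda>t. peval p (t *s v)) \<midarrow>0\<rightarrow> peval p 0"
proof -
  have "(\<lambda>t. peval p (t *s v)) \<midarrow>0\<rightarrow> peval p (0 *s v)"
    unfolding peval_eq_sum monom_eval_scale by (intro tendsto_intros)
  then show ?thesis by simp
qed

section \<open>Derivatives\<close>

lemma lookup_pdiff:
  "Poly_Mapping.lookup (pdiff j p) m =
     of_nat (Poly_Mapping.lookup m j + 1) * Poly_Mapping.lookup p (m + Poly_Mapping.single j 1)"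
proof -
  let ?e = "Poly_Mapping.single j (1::nat)"
  have eq: "k - ?e = m \<longleftrightarrow> k = m + ?e" if "Poly_Mapping.lookup k j \<noteq> 0" for k
  proof
    assume m: "k - ?e = m"
    show "k = m + ?e"
    proof (rule poly_mapping_eqI)
      fix i
      show "Poly_Mapping.lookup k i = Poly_Mapping.lookup (m + ?e) i"
        using that unfolding m[symmetric]
        by (cases "i = j") (auto simp: lookup_add lookup_minus lookup_single when_def)
    qed
  qed simp
  have "Poly_Mapping.lookup (pdiff j p) m =
    (\<Sum>k\<in>Poly_Mapping.keys p. if k = m + ?e
       then of_nat (Poly_Mapping.lookup m j + 1) * Poly_Mapping.lookup p k else 0)"
    unfolding pdiff_def lookup_sum
  proof (intro sum.cong refl)
    fix k
    show "Poly_Mapping.lookup (Poly_Mapping.single (k - ?e)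
        (of_nat (Poly_Mapping.lookup k j) * Poly_Mapping.lookup p k)) m =
      (if k = m + ?e then of_nat (Poly_Mapping.lookup m j + 1) * Poly_Mapping.lookup p k else 0)"
    proof (cases "Poly_Mapping.lookup k j = 0")
      case True
      then have "k \<noteq> m + ?e" by (auto simp: lookup_add)
      with True show ?thesis by simp
    next
      case False
      then show ?thesis using eq[OF False]
        by (auto simp: lookup_single when_def lookup_add)
    qed
  qed
  then show ?thesis by (auto simp: in_keys_iff)
qed

lemma pdiff_add: "pdiff j (p + q) = pdiff j p + pdiff j q"
  by (rule poly_mapping_eqI) (simp add: lookup_pdiff lookup_add ring_distribs)

lemma pdiff_single: "pdiff j (Poly_Mapping.single m c) =
    Poly_Mapping.single (m - Poly_Mapping.single j 1) (of_nat (Poly_Mapping.lookup m j) * c)"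
  by (simp add: pdiff_def)

lemma pdiff_commute: "pdiff j (pdiff k p) = pdiff k (pdiff j p)"
  by (rule poly_mapping_eqI) (simp add: lookup_pdiff lookup_add lookup_single when_def ac_simps)

lemma of_nat_mult_monom_eval_diff:
  "of_nat (Poly_Mapping.lookup m j) * monom_eval (m - Poly_Mapping.single j 1) v =
   of_nat (Poly_Mapping.lookup m j) * (v $ j) ^ (Poly_Mapping.lookup m j - 1) *
     (\<Prod>i\<in>UNIV - {j}. (v $ i) ^ Poly_Mapping.lookup m i)"
proof -
  have "(\<Prod>i\<in>UNIV - {j}. (v $ i) ^ Poly_Mapping.lookup (m - Poly_Mapping.single j 1) i) =
      (\<Prod>i\<in>UNIV - {j}. (v $ i) ^ Poly_Mapping.lookup m i)"
    by (intro prod.cong) (auto simp: lookup_minus lookup_single when_def)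
  then show ?thesis
    unfolding monom_eval_def by (subst prod.remove[of _ j]) (auto simp: lookup_minus)
qed

text \<open>
  Since the formal derivative is the analytic one, Leibniz' rule and the chain rule for
  translations follow from the uniqueness of derivatives.
\<close>
lemma DERIV_peval:
  "((\<lambda>t. peval p (v + t *s axis j 1)) has_field_derivative peval (pdiff j p) v) (at 0)"
proof (induction p rule: mpoly_induct)
  case (single m c)
  let ?R = "\<Prod>i\<in>UNIV - {j}. (v $ i) ^ Poly_Mapping.lookup m i"
  have *: "monom_eval m (v + t *s axis j 1) = (v $ j + t) ^ Poly_Mapping.lookup m j * ?R" for t
  proof -
    have "(\<Prod>i\<in>UNIV - {j}. ((v + t *s axis j 1) $ i) ^ Poly_Mapping.lookup m i) = ?R"
      by (intro prod.cong) (auto simp: axis_def)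
    then show ?thesis
      unfolding monom_eval_def by (subst prod.remove[of _ j]) (auto simp: axis_def)
  qed
  have "((\<lambda>t. c * ((v $ j + t) ^ Poly_Mapping.lookup m j * ?R)) has_field_derivative
      c * (of_nat (Poly_Mapping.lookup m j) * (v $ j) ^ (Poly_Mapping.lookup m j - 1) * ?R)) (at 0)"
    by (auto intro!: derivative_eq_intros)
  moreover have "c * (of_nat (Poly_Mapping.lookup m j) * (v $ j) ^ (Poly_Mapping.lookup m j - 1) * ?R)
      = peval (pdiff j (Poly_Mapping.single m c)) v"
    unfolding pdiff_single peval_single of_nat_mult_monom_eval_diff[symmetric] by simp
  ultimately show ?case
    by (simp only: peval_single *)
next
  case (add p q)
  then show ?case by (simp add: pdiff_add DERIV_add)
qed

lemma peval_pdiff_unique: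
  assumes "((\<lambda>t. peval p (v + t *s axis j 1)) has_field_derivative d) (at 0)"
  shows "peval (pdiff j p) v = d"
  using DERIV_unique[OF DERIV_peval assms] .

lemma peval_pdiff_mult:
  "peval (pdiff j (p * q)) v = peval p v * peval (pdiff j q) v + peval (pdiff j p) v * peval q v"
proof (rule peval_pdiff_unique)
  show "((\<lambda>t. peval (p * q) (v + t *s axis j 1)) has_field_derivative
      peval p v * peval (pdiff j q) v + peval (pdiff j p) v * peval q v) (at 0)"
    using DERIV_mult'[OF DERIV_peval[of p v j] DERIV_peval[of q v j]] by simp
qed

lemma peval_pdiff_cong:
  assumes "\<And>w. peval p (v + w) = peval q (u + w)"
  shows "peval (pdiff j p) v = peval (pdiff j q) u"
  by (rule peval_pdiff_unique) (simp add: assms DERIV_peval)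

lemma mpoly_eq_zero_if_derivatives_zero:
  assumes "Poly_Mapping.lookup p 0 = 0" "\<And>j. pdiff j p = (0 :: 'n::finite mpoly)"
  shows "p = 0"
proof (rule poly_mapping_eqI)
  fix m
  show "Poly_Mapping.lookup p m = Poly_Mapping.lookup 0 m"
  proof (cases "m = 0")
    case False
    then obtain j where j: "Poly_Mapping.lookup m j \<noteq> 0"
      by (metis lookup_zero poly_mapping_eqI)
    have "m = (m - Poly_Mapping.single j 1) + Poly_Mapping.single j 1"
      by (rule poly_mapping_eqI)
        (use j in \<open>auto simp: lookup_add lookup_minus lookup_single when_def\<close>)
    with assms(2)[of j] lookup_pdiff[of j p "m - Poly_Mapping.single j 1"] show ?thesis
      by (auto simp del: of_nat_add of_nat_Suc)
  qed (use assms in auto)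
qed

lemma monom_degree_add: "monom_degree (m + m') = monom_degree m + monom_degree m'"
  by (simp add: monom_degree_def lookup_add sum.distrib)

lemma monom_degree_single [simp]: "monom_degree (Poly_Mapping.single j k) = k"
  by (simp add: monom_degree_def lookup_single when_def)

lemma monom_degree_eq_0_iff [simp]: "monom_degree m = 0 \<longleftrightarrow> m = 0"
  by (auto simp: monom_degree_def intro: poly_mapping_eqI)

lemma keys_pdiff: "m \<in> Poly_Mapping.keys (pdiff j p) \<Longrightarrow>
    m + Poly_Mapping.single j 1 \<in> Poly_Mapping.keys p"
  by (auto simp: in_keys_iff lookup_pdiff)

text \<open>
  The partial derivatives of a polynomial vanishing everywhere vanish everywhere and have smaller
  degree, so by induction they are zero polynomials, and only the constant term remains.
\<close>
lemma mpoly_eq_zero_if_peval_zero: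
  fixes p :: "'n::finite mpoly"
  assumes "\<And>v. peval p v = 0"
  shows "p = 0"
proof -
  have "p = 0" if "\<forall>m\<in>Poly_Mapping.keys p. monom_degree m \<le> n" "\<And>v. peval p v = 0" for n p
    using that
  proof (induction n arbitrary: p)
    case 0
    then have "Poly_Mapping.keys p \<subseteq> {0}" by auto
    moreover have "Poly_Mapping.lookup p 0 = 0"
      using 0(2)[of 0] by (simp add: peval_at_zero)
    ultimately show ?case by (auto intro!: poly_mapping_eqI simp: in_keys_iff)
  next
    case (Suc n)
    show ?case
    proof (rule mpoly_eq_zero_if_derivatives_zero)
      show "Poly_Mapping.lookup p 0 = 0"
        using Suc.prems(2)[of 0] by (simp add: peval_at_zero)
      fix j
      show "pdiff j p = 0"
      proof (rule Suc.IH)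
        show "\<forall>m\<in>Poly_Mapping.keys (pdiff j p). monom_degree m \<le> n"
          using Suc.prems(1) by (auto dest!: keys_pdiff simp: monom_degree_add)
        show "peval (pdiff j p) v = 0" for v
          by (rule peval_pdiff_unique) (simp add: Suc.prems(2))
      qed
    qed
  qed
  from this[of p "Max (monom_degree ` Poly_Mapping.keys p)"] show ?thesis
    using assms by auto
qed

lemma mpoly_eqI:
  fixes p q :: "'n::finite mpoly"
  assumes "\<And>v. peval p v = peval q v"
  shows "p = q"
  using mpoly_eq_zero_if_peval_zero[of "p - q"] assms by simp

section \<open>Homogeneous polynomials\<close>

lemma peval_scale_homogeneous:
  assumes "homogeneous d p"
  shows "peval p (t *s v) = t ^ d * peval p v"
  using assms unfolding peval_eq_sum homogeneous_def sum_distrib_left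
  by (intro sum.cong) (auto simp: monom_eval_scale)

lemma homogeneous_pdiff: "homogeneous (Suc d) p \<Longrightarrow> homogeneous d (pdiff j p)"
  unfolding homogeneous_def by (auto dest!: keys_pdiff simp: monom_degree_add)

lemma homogeneous_0_peval: "homogeneous 0 p \<Longrightarrow> peval p v = peval p 0"
  using peval_scale_homogeneous[of 0 p 0 v] by simp

lemma homogeneous_add: "homogeneous d p \<Longrightarrow> homogeneous d q \<Longrightarrow> homogeneous d (p + q)"
  unfolding homogeneous_def using keys_add[of p q] by blast

lemma homogeneous_diff: "homogeneous d p \<Longrightarrow> homogeneous d q \<Longrightarrow> homogeneous d (p - q)"
  unfolding homogeneous_def by (metis in_keys_iff lookup_minus diff_zero)

lemma homogeneous_mult: "homogeneous d p \<Longrightarrow> homogeneous e q \<Longrightarrow> homogeneous (d + e) (p * q)"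
  unfolding homogeneous_def using keys_mult[of p q] by (auto simp: monom_degree_add)

lemma homogeneous_sum: "(\<And>i. i \<in> I \<Longrightarrow> homogeneous d (f i)) \<Longrightarrow> homogeneous d (\<Sum>i\<in>I. f i)"
  by (induction I rule: infinite_finite_induct) (simp_all add: homogeneous_add, simp_all add: homogeneous_def)

lemma homogeneous_Const: "homogeneous 0 (Const c)"
  by (auto simp: homogeneous_def)

lemma homogeneous_Var: "homogeneous 1 (Var j)"
  by (auto simp: homogeneous_def)

lemma homogeneous_linear: "homogeneous 1 (\<Sum>j\<in>UNIV. Const (l j) * Var j)"
proof (rule homogeneous_sum)
  show "homogeneous 1 (Const (l j) * Var j)" for j
    using homogeneous_mult[OF homogeneous_Const homogeneous_Var] by (simp only: add_0)
qed

lemma euler_homogeneous: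
  assumes "homogeneous d p"
  shows "(\<Sum>j\<in>UNIV. v $ j * peval (pdiff j p) v) = of_nat d * peval p v"
proof -
  have *: "v $ j * (of_nat (Poly_Mapping.lookup m j) * monom_eval (m - Poly_Mapping.single j 1) v)
      = of_nat (Poly_Mapping.lookup m j) * monom_eval m v" for m j
  proof (cases "Poly_Mapping.lookup m j")
    case (Suc n)
    have "m = (m - Poly_Mapping.single j 1) + Poly_Mapping.single j 1"
      by (rule poly_mapping_eqI)
        (use Suc in \<open>auto simp: lookup_add lookup_minus lookup_single when_def\<close>)
    then have "monom_eval m v = monom_eval (m - Poly_Mapping.single j 1) v * v $ j"
      by (metis monom_eval_add monom_eval_single power_one_right)
    then show ?thesis by simp
  qed simp
  have "(\<Sum>j\<in>UNIV. v $ j * peval (pdiff j p) v) =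
    (\<Sum>j\<in>UNIV. \<Sum>m\<in>Poly_Mapping.keys p. Poly_Mapping.lookup p m *
      (v $ j * (of_nat (Poly_Mapping.lookup m j) * monom_eval (m - Poly_Mapping.single j 1) v)))"
    unfolding pdiff_def peval_sum peval_single sum_distrib_left
    by (intro sum.cong) (auto simp: ac_simps)
  also have "\<dots> = (\<Sum>m\<in>Poly_Mapping.keys p. of_nat (monom_degree m) * (Poly_Mapping.lookup p m * monom_eval m v))"
    unfolding * by (subst sum.swap)
      (simp add: monom_degree_def sum_distrib_left sum_distrib_right ac_simps)
  also have "\<dots> = of_nat d * peval p v"
    using assms unfolding peval_eq_sum sum_distrib_left homogeneous_def by (intro sum.cong) auto
  finally show ?thesis .
qed

section \<open>The trilinear form of a cubic form\<close>

text \<open>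
  The third derivatives of a cubic form are constants; evaluating them at 0 makes \<open>polar p\<close> a
  symmetric trilinear form for every polynomial \<open>p\<close>.
\<close>
definition polar :: "'n::finite mpoly \<Rightarrow> complex ^ 'n \<Rightarrow> complex ^ 'n \<Rightarrow> complex ^ 'n \<Rightarrow> complex" where
  "polar p u v w = (\<Sum>a\<in>UNIV. \<Sum>b\<in>UNIV. \<Sum>c\<in>UNIV.
     u $ a * (v $ b * (w $ c * peval (pdiff a (pdiff b (pdiff c p))) 0)))"

lemma polar_swap12: "polar p u v w = polar p v u w"
  unfolding polar_def
  by (subst sum.swap) (intro sum.cong refl, simp add: pdiff_commute ac_simps)

lemma polar_swap23: "polar p u v w = polar p u w v"
  unfolding polar_def
  by (rule sum.cong, rule refl, subst sum.swap)
    (intro sum.cong refl, simp add: pdiff_commute ac_simps)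

lemma polar_add1: "polar p (u + u') v w = polar p u v w + polar p u' v w"
  by (simp add: polar_def ring_distribs sum.distrib)

lemma polar_scale1: "polar p (k *s u) v w = k * polar p u v w"
  by (simp add: polar_def sum_distrib_left ac_simps)

lemma polar_add2: "polar p u (v + v') w = polar p u v w + polar p u v' w"
  by (metis polar_add1 polar_swap12)

lemma polar_scale2: "polar p u (k *s v) w = k * polar p u v w"
  by (metis polar_scale1 polar_swap12)

lemma polar_add3: "polar p u v (w + w') = polar p u v w + polar p u v w'"
  by (metis polar_add2 polar_swap23)

lemma polar_scale3: "polar p u v (k *s w) = k * polar p u v w"
  by (metis polar_scale2 polar_swap23)

lemma vec_diff_eq_add_scale: "u - v = u + (- 1) *s (v :: complex ^ 'n)"
  by (simp add: vec_eq_iff)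

lemma polar_diff1: "polar p (u - u') v w = polar p u v w - polar p u' v w"
  unfolding vec_diff_eq_add_scale polar_add1 polar_scale1 by simp

lemma polar_diff2: "polar p u (v - v') w = polar p u v w - polar p u v' w"
  unfolding vec_diff_eq_add_scale polar_add2 polar_scale2 by simp

lemma polar_diff3: "polar p u v (w - w') = polar p u v w - polar p u v w'"
  unfolding vec_diff_eq_add_scale polar_add3 polar_scale3 by simp

lemmas polar_linear =
  polar_add1 polar_add2 polar_add3 polar_scale1 polar_scale2 polar_scale3
  polar_diff1 polar_diff2 polar_diff3

lemma polar_zero3 [simp]: "polar p u v 0 = 0"
  by (simp add: polar_def)

lemma polar_sum3: "polar p u v (\<Sum>i\<in>I. f i) = (\<Sum>i\<in>I. polar p u v (f i))"
  by (induction I rule: infinite_finite_induct) (auto simp: polar_add3)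

lemma polar_sum_axis: "polar p u v w = (\<Sum>j\<in>UNIV. w $ j * polar p u v (axis j 1))"
  by (subst basis_expansion[of w, symmetric]) (simp only: polar_sum3 polar_scale3)

definition dir_deriv :: "'n::finite mpoly \<Rightarrow> complex ^ 'n \<Rightarrow> complex ^ 'n \<Rightarrow> complex" where
  "dir_deriv p v w = (\<Sum>j\<in>UNIV. w $ j * peval (pdiff j p) v)"

lemma peval_homogeneous_1:
  assumes "homogeneous 1 q"
  shows "peval q v = (\<Sum>c\<in>UNIV. v $ c * peval (pdiff c q) 0)"
proof -
  have "homogeneous 0 (pdiff c q)" for c
    using homogeneous_pdiff[of 0 q] assms by simp
  then have "peval (pdiff c q) v = peval (pdiff c q) 0" for c
    by (rule homogeneous_0_peval)
  with euler_homogeneous[OF assms, of v] show ?thesis by simp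
qed

context
  fixes p :: "'n::finite mpoly"
  assumes cubic: "homogeneous 3 p"
begin

lemma homogeneous_pdiff_cubic: "homogeneous 2 (pdiff b p)"
  using homogeneous_pdiff[of 2 p] cubic by (simp add: numeral_3_eq_3 numeral_2_eq_2)

lemma homogeneous_pdiff_pdiff_cubic: "homogeneous 1 (pdiff a (pdiff b p))"
  using homogeneous_pdiff[of 1 "pdiff b p"] homogeneous_pdiff_cubic by (simp add: numeral_2_eq_2)

lemma polar_eq_second_derivatives:
  "polar p v x y = (\<Sum>b\<in>UNIV. \<Sum>c\<in>UNIV. x $ b * (y $ c * peval (pdiff b (pdiff c p)) v))"
proof -
  have "polar p v x y = (\<Sum>b\<in>UNIV. \<Sum>c\<in>UNIV. \<Sum>a\<in>UNIV.
      v $ a * (x $ b * (y $ c * peval (pdiff a (pdiff b (pdiff c p))) 0)))"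
    unfolding polar_def by (subst sum.swap) (intro sum.cong refl sum.swap)
  then show ?thesis
    by (simp add: peval_homogeneous_1[OF homogeneous_pdiff_pdiff_cubic] sum_distrib_left ac_simps)
qed

lemma polar_eq_dir_deriv: "polar p v v w = 2 * dir_deriv p v w"
proof -
  have "polar p v v w = (\<Sum>c\<in>UNIV. w $ c * (\<Sum>b\<in>UNIV. v $ b * peval (pdiff b (pdiff c p)) v))"
    unfolding polar_eq_second_derivatives
    by (subst sum.swap) (simp add: sum_distrib_left ac_simps)
  also have "\<dots> = 2 * dir_deriv p v w"
    unfolding euler_homogeneous[OF homogeneous_pdiff_cubic] dir_deriv_def
    by (simp add: sum_distrib_left ac_simps)
  finally show ?thesis .
qed

lemma polar_eq_peval: "polar p v v v = 6 * peval p v"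
  using polar_eq_dir_deriv[of v v] euler_homogeneous[OF cubic, of v]
  by (simp add: dir_deriv_def)

text \<open>
  Polarization recovers the trilinear form from the values of the cubic form alone, so that
  relations between values of cubic forms carry over to their derivatives.
\<close>
lemma polarization:
  "polar p u v w = peval p (u + v + w) - peval p (u + v) - peval p (u + w) - peval p (v + w)
     + peval p u + peval p v + peval p w"
proof -
  have "6 * polar p u v w = 6 * (peval p (u + v + w) - peval p (u + v) - peval p (u + w)
      - peval p (v + w) + peval p u + peval p v + peval p w)"
    unfolding right_diff_distrib distrib_left polar_eq_peval[symmetric] polar_linear
    by (simp add: polar_swap12 polar_swap23)
  then show ?thesis unfolding mult_cancel_left by simp
qed

end

lemma polar_combination:
  assumes "homogeneous 3 F" "homogeneous 3 G" "homogeneous 3 H"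
    and "\<And>x. peval H x = \<alpha> * peval F x + \<beta> * peval G x"
  shows "polar H u v w = \<alpha> * polar F u v w + \<beta> * polar G u v w"
  unfolding polarization[OF assms(1)] polarization[OF assms(2)] polarization[OF assms(3)] assms(4)
  by (simp add: algebra_simps)

lemma gradient_zero_if_polar_zero:
  assumes "homogeneous 3 c" "\<And>w. polar c z z w = 0"
  shows "gradient c z = 0"
proof -
  have "peval (pdiff j c) z = 0" for j
  proof -
    have "dir_deriv c z (axis j 1) = (\<Sum>i\<in>UNIV. if i = j then peval (pdiff j c) z else 0)"
      unfolding dir_deriv_def by (intro sum.cong) (auto simp: axis_def)
    then show ?thesis
      using polar_eq_dir_deriv[OF assms(1), of z "axis j 1"] assms(2) by simp
  qed
  then show ?thesis by (simp add: gradient_def vec_eq_iff)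
qed


section \<open>Vertices of the members of a pencil\<close>

definition vertex_space :: "'n::finite mpoly \<Rightarrow> 'n mpoly \<Rightarrow> complex \<Rightarrow> complex \<Rightarrow> (complex ^ 'n) set" where
  "vertex_space F G \<alpha> \<beta> = {u. \<forall>x y. \<alpha> * polar F u x y + \<beta> * polar G u x y = 0}"

text \<open>
  The point \<open>v\<close> is a vertex of the member \<open>\<alpha> F + \<beta> G\<close> and a zero of the pencil. The linear forms
  \<open>polar F v v\<close> and \<open>polar G v v\<close> are, up to the factor 2, the differentials of \<open>F\<close> and \<open>G\<close> at
  \<open>v\<close>; they are proportional, because \<open>\<alpha> F + \<beta> G\<close> is singular at \<open>v\<close>. The last condition says
  that the vertex space meets their common kernel, the tangent hyperplane at \<open>v\<close>, only in the
  line spanned by \<open>v\<close>.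
\<close>
definition transversal_vertex ::
    "'n::finite mpoly \<Rightarrow> 'n mpoly \<Rightarrow> complex \<Rightarrow> complex \<Rightarrow> complex ^ 'n \<Rightarrow> bool" where
  "transversal_vertex F G \<alpha> \<beta> v \<longleftrightarrow> (\<alpha>, \<beta>) \<noteq> (0, 0) \<and> v \<in> vertex_space F G \<alpha> \<beta> \<and>
     polar F v v v = 0 \<and> polar G v v v = 0 \<and> (\<exists>w. polar F v v w \<noteq> 0 \<or> polar G v v w \<noteq> 0) \<and>
     (\<forall>u\<in>vertex_space F G \<alpha> \<beta>. polar F v v u = 0 \<longrightarrow> polar G v v u = 0 \<longrightarrow> (\<exists>s. u = s *s v))"

lemma vertex_space_add: "u \<in> vertex_space F G \<alpha> \<beta> \<Longrightarrow> u' \<in> vertex_space F G \<alpha> \<beta> \<Longrightarrow>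
    u + u' \<in> vertex_space F G \<alpha> \<beta>"
  unfolding vertex_space_def mem_Collect_eq polar_add1 distrib_left
  by (metis add.assoc add.commute add_0)

lemma vertex_space_scale: "u \<in> vertex_space F G \<alpha> \<beta> \<Longrightarrow> k *s u \<in> vertex_space F G \<alpha> \<beta>"
  unfolding vertex_space_def mem_Collect_eq polar_scale1
  by (metis distrib_left mult.left_commute mult_zero_right)

lemma vertex_space_zero: "0 \<in> vertex_space F G \<alpha> \<beta>"
  by (simp add: vertex_space_def polar_def)

lemma vertex_space_sum: "(\<And>i. i \<in> I \<Longrightarrow> f i \<in> vertex_space F G \<alpha> \<beta>) \<Longrightarrow>
    (\<Sum>i\<in>I. f i) \<in> vertex_space F G \<alpha> \<beta>"
  by (induction I rule: infinite_finite_induct)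
    (simp_all add: vertex_space_zero vertex_space_add)

lemma vertex_space_diff_scale: "u \<in> vertex_space F G \<alpha> \<beta> \<Longrightarrow> u' \<in> vertex_space F G \<alpha> \<beta> \<Longrightarrow>
    u - k *s u' \<in> vertex_space F G \<alpha> \<beta>"
  unfolding vec_diff_eq_add_scale by (intro vertex_space_add vertex_space_scale)

lemma transversal_vertex_nonzero: "transversal_vertex F G \<alpha> \<beta> v \<Longrightarrow> v \<noteq> 0"
  by (auto simp: transversal_vertex_def polar_def)

lemma vertex_space_subset_if_proportional:
  assumes "(\<alpha>, \<beta>) \<noteq> (0, 0)" "\<alpha> * \<beta>' = \<alpha>' * \<beta>"
  shows "vertex_space F G \<alpha> \<beta> \<subseteq> vertex_space F G \<alpha>' \<beta>'"
proof
  fix u assume u: "u \<in> vertex_space F G \<alpha> \<beta>"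
  show "u \<in> vertex_space F G \<alpha>' \<beta>'"
    unfolding vertex_space_def mem_Collect_eq
  proof (intro allI)
    fix x y
    let ?f = "polar F u x y" and ?g = "polar G u x y"
    have 0: "\<alpha> * ?f + \<beta> * ?g = 0"
      using u by (simp add: vertex_space_def)
    have "\<alpha> * (\<alpha>' * ?f + \<beta>' * ?g) = \<alpha>' * (\<alpha> * ?f + \<beta> * ?g)"
      using assms(2) by algebra
    moreover have "\<beta> * (\<alpha>' * ?f + \<beta>' * ?g) = \<beta>' * (\<alpha> * ?f + \<beta> * ?g)"
      using assms(2) by algebra
    ultimately show "\<alpha>' * ?f + \<beta>' * ?g = 0"
      using assms(1) unfolding 0 by auto
  qed
qed

text \<open>
  As a function of the member, \<open>polar\<close> at the pair \<open>v, v'\<close> is linear on the pencil and vanishes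
  at two members; if these are not proportional, it vanishes on the whole pencil. Proportional
  members would have the same vertex space.
\<close>
lemma polar_vertices_of_distinct_members:
  assumes "transversal_vertex F G \<alpha> \<beta> v" "transversal_vertex F G \<alpha>' \<beta>' v'"
    and "vertex_space F G \<alpha> \<beta> \<noteq> vertex_space F G \<alpha>' \<beta>'"
  shows "polar F v v' x = 0 \<and> polar G v v' x = 0"
proof (rule ccontr)
  let ?f = "polar F v v' x" and ?g = "polar G v v' x"
  assume fg: "\<not> (?f = 0 \<and> ?g = 0)"
  have 1: "\<alpha> * ?f + \<beta> * ?g = 0"
    using assms(1) by (simp add: transversal_vertex_def vertex_space_def)
  have "\<alpha>' * polar F v' v x + \<beta>' * polar G v' v x = 0"
    using assms(2) by (simp add: transversal_vertex_def vertex_space_def)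
  then have 2: "\<alpha>' * ?f + \<beta>' * ?g = 0"
    by (simp only: polar_swap12[of _ v v'])
  have "(\<alpha> * \<beta>' - \<alpha>' * \<beta>) * ?f = \<beta>' * (\<alpha> * ?f + \<beta> * ?g) - \<beta> * (\<alpha>' * ?f + \<beta>' * ?g)"
    "(\<alpha> * \<beta>' - \<alpha>' * \<beta>) * ?g = \<alpha> * (\<alpha>' * ?f + \<beta>' * ?g) - \<alpha>' * (\<alpha> * ?f + \<beta> * ?g)"
    by (simp_all add: algebra_simps)
  then have "\<alpha> * \<beta>' = \<alpha>' * \<beta>"
    using fg unfolding 1 2 by auto
  moreover have "(\<alpha>, \<beta>) \<noteq> (0, 0)" "(\<alpha>', \<beta>') \<noteq> (0, 0)"
    using assms(1,2) by (simp_all add: transversal_vertex_def)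
  ultimately have "vertex_space F G \<alpha> \<beta> = vertex_space F G \<alpha>' \<beta>'"
    using vertex_space_subset_if_proportional[of \<alpha> \<beta> \<beta>' \<alpha>' F G]
      vertex_space_subset_if_proportional[of \<alpha>' \<beta>' \<beta> \<alpha> F G] by auto
  with assms(3) show False ..
qed

context
  fixes F G :: "'n::finite mpoly" and S :: "'i set"
    and v :: "'i \<Rightarrow> complex ^ 'n" and \<alpha> \<beta> :: "'i \<Rightarrow> complex"
  assumes vertex: "\<And>i. i \<in> S \<Longrightarrow> transversal_vertex F G (\<alpha> i) (\<beta> i) (v i)"
    and distinct: "\<And>i j s. i \<in> S \<Longrightarrow> j \<in> S \<Longrightarrow> v i = s *s v j \<Longrightarrow> i = j"
begin

abbreviation member_vertices :: "'i \<Rightarrow> (complex ^ 'n) set" where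
  "member_vertices i \<equiv> vertex_space F G (\<alpha> i) (\<beta> i)"

text \<open>
  Let \<open>u\<close> be the part of the relation that belongs to the member with vertex \<open>v i\<close>. Pairing the
  relation with \<open>v i\<close> kills all other parts by orthogonality, so \<open>u\<close> is orthogonal to \<open>v i\<close>. By
  transversality \<open>u\<close> is then a multiple of \<open>v i\<close>, and it is zero as the differentials at \<open>v i\<close> are
  not both zero. So the relation splits into one relation for each member, between at most two
  distinct points.
\<close>
lemma vertices_independent_scalars:
  assumes B: "B \<subseteq> S" "finite B" "\<And>i. i \<in> B \<Longrightarrow> card {j \<in> B. member_vertices j = member_vertices i} \<le> 2"
    and zero: "(\<Sum>j\<in>B. c j *s v j) = 0" and "i \<in> B"
  shows "c i = 0"
proof -
  let ?C = "{j \<in> B. member_vertices j = member_vertices i}"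
  define u where "u = (\<Sum>j\<in>?C. c j *s v j)"
  have i: "i \<in> S" "transversal_vertex F G (\<alpha> i) (\<beta> i) (v i)"
    using vertex B(1) \<open>i \<in> B\<close> by auto
  have vW: "v j \<in> member_vertices i" if "j \<in> ?C" for j
    using that vertex[of j] B(1) by (auto simp: transversal_vertex_def)
  then have uW: "u \<in> member_vertices i"
    unfolding u_def by (intro vertex_space_sum vertex_space_scale)
  have orth: "polar K (v i) x u = 0" if K: "K \<in> {F, G}" for K x
  proof -
    have "polar K (v i) x u = (\<Sum>j\<in>?C. c j * polar K (v i) x (v j))"
      unfolding u_def by (simp add: polar_sum3 polar_scale3)
    also have "\<dots> = (\<Sum>j\<in>B. c j * polar K (v i) x (v j))"
    proof (rule sum.mono_neutral_left)
      show "\<forall>j\<in>B - ?C. c j * polar K (v i) x (v j) = 0"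
        using polar_vertices_of_distinct_members[OF i(2) vertex] K B(1)
        by (auto simp: polar_swap23[of _ "v i" x])
    qed (use B in auto)
    also have "\<dots> = polar K (v i) x (\<Sum>j\<in>B. c j *s v j)"
      by (simp add: polar_sum3 polar_scale3)
    finally show ?thesis by (simp add: zero)
  qed
  obtain s where s: "u = s *s v i"
    using i(2) uW orth unfolding transversal_vertex_def by blast
  obtain w K where K: "K \<in> {F, G}" "polar K (v i) (v i) w \<noteq> 0"
    using i(2) unfolding transversal_vertex_def by blast
  have "s * polar K (v i) w (v i) = 0"
    using orth[OF K(1), of w] unfolding s polar_scale3 .
  then have "s = 0" using K(2) by (simp add: polar_swap23[of K "v i" w])
  then have u0: "u = 0" by (simp add: s)
  show ?thesis
  proof (cases "?C = {i}")
    case True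
    then show ?thesis using u0 transversal_vertex_nonzero[OF i(2)] by (simp add: u_def)
  next
    case False
    then obtain k where k: "k \<in> ?C" "k \<noteq> i"
      using \<open>i \<in> B\<close> by blast
    have "{i, k} = ?C"
      using k B(2) B(3)[OF \<open>i \<in> B\<close>] \<open>i \<in> B\<close> by (intro card_seteq) auto
    then have "c i *s v i + c k *s v k = 0"
      using u0 k(2) unfolding u_def by (metis (no_types, lifting) finite.emptyI finite.insertI
          empty_iff insert_iff sum.empty sum.insert add.right_neutral)
    then have eq: "c i *s v i = (- c k) *s v k"
      by (simp add: eq_neg_iff_add_eq_0)
    show ?thesis
    proof (rule ccontr)
      assume "c i \<noteq> 0"
      then have "v i = inverse (c i) *s (c i *s v i)"
        by simp
      also have "\<dots> = (inverse (c i) * - c k) *s v k"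
        unfolding eq by simp
      finally show False
        using distinct[of i k] i(1) k B(1) by blast
    qed
  qed
qed

lemma card_vertices_two_per_member:
  assumes B: "B \<subseteq> S" "finite B" "\<And>i. i \<in> B \<Longrightarrow> card {j \<in> B. member_vertices j = member_vertices i} \<le> 2"
  shows "card B \<le> CARD('n)"
proof -
  have inj: "inj_on v B"
    using distinct[of _ _ 1] B(1) by (auto simp: inj_on_def)
  have "vec.independent (v ` B)"
  proof (rule vec.independent_if_scalars_zero)
    fix f x assume f: "(\<Sum>x\<in>v ` B. f x *s x) = 0" and x: "x \<in> v ` B"
    have "(\<Sum>j\<in>B. f (v j) *s v j) = 0"
      using f by (simp add: sum.reindex[OF inj] o_def)
    then show "f x = 0"
      using vertices_independent_scalars[OF B, of "\<lambda>j. f (v j)"] x by blast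
  qed (use B in simp)
  then have "card (v ` B) \<le> vec.dim (UNIV :: (complex ^ 'n) set)"
    by (intro vec.independent_card_le_dim) simp_all
  then show ?thesis
    unfolding vec_dim_card card_image[OF inj] .
qed

text \<open>
  If \<open>v i\<close> and \<open>v j\<close> are two of the points, transversality at \<open>v i\<close> puts every other vertex of
  the member into their span. A member \<open>K\<close> of the pencil with nonzero differential at the points
  restricts to \<open>a *s v i + b *s v j\<close> as \<open>a b (a m + b m') / 2\<close> with nonzero \<open>m\<close> and \<open>m'\<close>, so
  there is exactly one further zero up to scaling.
\<close>
lemma card_vertices_of_member:
  assumes "finite S" "i \<in> S"
  shows "card {j \<in> S. member_vertices j = member_vertices i} \<le> 3"
proof (cases "{j \<in> S. member_vertices j = member_vertices i} = {i}")
  case False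
  let ?C = "{j \<in> S. member_vertices j = member_vertices i}"
  obtain j where j: "j \<in> ?C" "j \<noteq> i" using False \<open>i \<in> S\<close> by blast
  (* The member itself has zero polar form on its vertices, so one of F and G, chosen once for the
     whole vertex space, determines the other one there. *)
  obtain K where K: "K \<in> {F, G}"
    "\<And>u x y. u \<in> member_vertices i \<Longrightarrow> polar K u x y = 0 \<Longrightarrow> polar F u x y = 0 \<and> polar G u x y = 0"
  proof (cases "\<beta> i = 0")
    case True
    with vertex[OF \<open>i \<in> S\<close>] have "\<alpha> i \<noteq> 0" by (auto simp: transversal_vertex_def)
    with True show ?thesis by (intro that[of G]) (auto simp: vertex_space_def)
  next
    case False
    show ?thesis
    proof (rule that[of F])
      fix u x y assume "u \<in> member_vertices i" "polar F u x y = 0"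
      have "\<alpha> i * polar F u x y + \<beta> i * polar G u x y = 0"
        using \<open>u \<in> member_vertices i\<close> by (simp add: vertex_space_def)
      then show "polar F u x y = 0 \<and> polar G u x y = 0"
        using \<open>polar F u x y = 0\<close> False by simp
    qed simp
  qed
  have vW: "v k \<in> member_vertices i" if "k \<in> ?C" for k
    using that vertex[of k] by (auto simp: transversal_vertex_def)
  have only: "\<exists>s. u = s *s v k" if "k \<in> ?C" "u \<in> member_vertices i" "polar K (v k) (v k) u = 0" for k u
  proof -
    have "polar F (v k) (v k) u = 0 \<and> polar G (v k) (v k) u = 0"
      using K(2)[OF vW[OF that(1)] that(3)] .
    then show ?thesis
      using vertex[of k] that unfolding transversal_vertex_def by auto
  qed
  have on_cubic: "polar K (v k) (v k) (v k) = 0" if "k \<in> ?C" for k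
    using vertex[of k] that K(1) unfolding transversal_vertex_def by auto
  have iC: "i \<in> ?C" using \<open>i \<in> S\<close> by simp
  define m where "m = polar K (v i) (v i) (v j)"
  define m' where "m' = polar K (v j) (v j) (v i)"
  have "m \<noteq> 0"
    using only[OF iC vW[OF j(1)]] distinct[of j i] j \<open>i \<in> S\<close> unfolding m_def by blast
  have "m' \<noteq> 0"
    using only[OF j(1) vW[OF iC]] distinct[of i j] j \<open>i \<in> S\<close> unfolding m'_def by blast
  have third: "\<exists>b. b \<noteq> 0 \<and> v k = b *s (v j - (m' / m) *s v i)" if k: "k \<in> ?C - {i, j}" for k
  proof -
    define b where "b = polar K (v i) (v i) (v k) / m"
    have "polar K (v i) (v i) (v k - b *s v j) = 0"
      using \<open>m \<noteq> 0\<close> by (simp add: polar_diff3 polar_scale3 b_def m_def)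
    then obtain a where a: "v k - b *s v j = a *s v i"
      using only[OF iC vertex_space_diff_scale[OF vW vW[OF j(1)]]] k by blast
    then have vk: "v k = a *s v i + b *s v j"
      by (simp add: algebra_simps)
    have "a \<noteq> 0"
    proof
      assume "a = 0"
      then have "v k = b *s v j" using vk by simp
      then show False using distinct[of k j] k j by blast
    qed
    have "b \<noteq> 0"
    proof
      assume "b = 0"
      then have "v k = a *s v i" using vk by simp
      then show False using distinct[of k i] k \<open>i \<in> S\<close> by blast
    qed
    have "0 = polar K (v k) (v k) (v k)"
      using on_cubic[of k] k by simp
    also have "\<dots> = 3 * a * b * (a * m + b * m')"
      unfolding vk by (simp add: polar_linear on_cubic[OF iC] on_cubic[OF j(1)] m_def m'_def
          polar_swap12[of K "v j" "v i"] polar_swap23[of K "v i" "v j" "v i"]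
          polar_swap23[of K "v j" "v j" "v i"] algebra_simps)
    finally have "a * m + b * m' = 0"
      using \<open>a \<noteq> 0\<close> \<open>b \<noteq> 0\<close> by simp
    then have "a = - b * (m' / m)"
      using \<open>m \<noteq> 0\<close> by (simp add: field_simps eq_neg_iff_add_eq_0)
    then have "v k = b *s (v j - (m' / m) *s v i)"
      unfolding vk by (simp add: vec_eq_iff algebra_simps)
    with \<open>b \<noteq> 0\<close> show ?thesis by blast
  qed
  have unique: "k = l" if k: "k \<in> ?C - {i, j}" and l: "l \<in> ?C - {i, j}" for k l
  proof -
    obtain b where b: "v k = b *s (v j - (m' / m) *s v i)" using third[OF k] by blast
    obtain b' where b': "b' \<noteq> 0" "v l = b' *s (v j - (m' / m) *s v i)" using third[OF l] by blast
    have "v k = (b / b') *s v l"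
      using b'(1) unfolding b b'(2) by simp
    then show ?thesis using distinct[of k l] k l by blast
  qed
  have "finite (?C - {i, j})" using \<open>finite S\<close> by simp
  then have "card (?C - {i, j}) \<le> Suc 0"
    unfolding card_le_Suc0_iff_eq[OF \<open>finite (?C - {i, j})\<close>] by (intro ballI unique)
  moreover have "card (?C - {i, j}) = card ?C - 2"
    using j iC \<open>finite S\<close> by (subst card_Diff_subset) auto
  ultimately show ?thesis by simp
qed simp

end

text \<open>
  Keeping two elements of every fibre with three elements, and everything else, retains at least
  two thirds of \<open>S\<close>.
\<close>
lemma card_le_of_fibres:
  assumes "finite S" "\<And>x. x \<in> S \<Longrightarrow> card {y \<in> S. f y = f x} \<le> 3"
    and "\<And>B. B \<subseteq> S \<Longrightarrow> (\<And>x. x \<in> B \<Longrightarrow> card {y \<in> B. f y = f x} \<le> 2) \<Longrightarrow> card B \<le> n"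
  shows "2 * card S \<le> 3 * n"
proof -
  let ?fib = "\<lambda>c. {y \<in> S. f y = c}"
  have "\<exists>T. T \<subseteq> ?fib c \<and> card T = min 2 (card (?fib c))" for c
    using obtain_subset_with_card_n[of "min 2 (card (?fib c))" "?fib c"] by auto
  then obtain T where T: "\<And>c. T c \<subseteq> ?fib c" "\<And>c. card (T c) = min 2 (card (?fib c))"
    by metis
  have Tf: "y \<in> S \<and> f y = c" if "y \<in> T c" for y c
    using T(1) that by blast
  define B where "B = (\<Union>c\<in>f ` S. T c)"
  have finT: "finite (T c)" for c
    using T(1)[of c] \<open>finite S\<close> by (auto intro: finite_subset)
  have "card B \<le> n"
  proof (rule assms(3))
    show "B \<subseteq> S" using T(1) by (auto simp: B_def)
    fix x assume "x \<in> B"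
    have "y \<in> T (f x)" if y: "y \<in> B" "f y = f x" for y
    proof -
      obtain c where "y \<in> T c" using y(1) by (auto simp: B_def)
      with Tf y(2) show ?thesis by metis
    qed
    then have "{y \<in> B. f y = f x} \<subseteq> T (f x)" by blast
    then have "card {y \<in> B. f y = f x} \<le> card (T (f x))"
      by (rule card_mono[OF finT])
    then show "card {y \<in> B. f y = f x} \<le> 2"
      using T(2)[of "f x"] by simp
  qed
  moreover have "card B = (\<Sum>c\<in>f ` S. card (T c))"
    unfolding B_def using \<open>finite S\<close> finT by (intro card_UN_disjoint) (auto dest!: Tf)
  moreover have "card S = (\<Sum>c\<in>f ` S. card (?fib c))"
  proof -
    have "S = (\<Union>c\<in>f ` S. ?fib c)" by auto
    then have "card S = card (\<Union>c\<in>f ` S. ?fib c)" by simp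
    also have "\<dots> = (\<Sum>c\<in>f ` S. card (?fib c))"
      using \<open>finite S\<close> by (intro card_UN_disjoint) auto
    finally show ?thesis .
  qed
  moreover have "2 * (\<Sum>c\<in>f ` S. card (?fib c)) \<le> 3 * (\<Sum>c\<in>f ` S. card (T c))"
    unfolding sum_distrib_left
  proof (rule sum_mono)
    fix c assume "c \<in> f ` S"
    then have "card (?fib c) \<le> 3" using assms(2) by auto
    then show "2 * card (?fib c) \<le> 3 * card (T c)"
      unfolding T(2) by (auto simp: min_def)
  qed
  ultimately show ?thesis by linarith
qed

lemma card_transversal_vertices:
  fixes F G :: "'n::finite mpoly"
  assumes "finite S" "\<And>i. i \<in> S \<Longrightarrow> transversal_vertex F G (\<alpha> i) (\<beta> i) (v i)"
    and "\<And>i j s. i \<in> S \<Longrightarrow> j \<in> S \<Longrightarrow> v i = s *s v j \<Longrightarrow> i = j"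
  shows "2 * card S \<le> 3 * CARD('n)"
proof (rule card_le_of_fibres[OF \<open>finite S\<close>])
  show "card {y \<in> S. vertex_space F G (\<alpha> y) (\<beta> y) = vertex_space F G (\<alpha> x) (\<beta> x)} \<le> 3"
    if "x \<in> S" for x
    by (rule card_vertices_of_member[OF assms(2,3,1) that])
  show "card B \<le> CARD('n)"
    if B: "B \<subseteq> S" "\<And>x. x \<in> B \<Longrightarrow>
      card {y \<in> B. vertex_space F G (\<alpha> y) (\<beta> y) = vertex_space F G (\<alpha> x) (\<beta> x)} \<le> 2" for B
    by (rule card_vertices_two_per_member[OF assms(2,3) B(1) finite_subset[OF B(1) assms(1)] B(2)])
qed

section \<open>Ideals generated by forms\<close>

text \<open>
  Ideals are submodules of the ring over itself, which makes the span lemmas available for them.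
\<close>
interpretation ideal: module "(*) :: 'n mpoly \<Rightarrow> 'n mpoly \<Rightarrow> 'n mpoly"
  by unfold_locales (simp_all add: algebra_simps)

lemma ideal_gen_pairE:
  assumes "p \<in> ideal_gen {F, G}"
  obtains a b where "p = a * F + b * G"
proof -
  obtain a where "p - a * F \<in> ideal_gen {G}"
    using assms by (auto simp: ideal.span_insert)
  then obtain b where "p - a * F = b * G"
    by (auto simp: ideal.span_singleton)
  then have "p = a * F + b * G"
    by (simp add: algebra_simps)
  then show ?thesis by (rule that)
qed

lemma eq_limit_at_0:
  fixes f :: "complex \<Rightarrow> complex"
  assumes "\<And>t. t \<noteq> 0 \<Longrightarrow> f t = c" "f \<midarrow>0\<rightarrow> l"
  shows "c = l"
proof -
  have "eventually (\<lambda>t. f t = c) (at 0)"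
    by (simp add: eventually_at_filter assms(1))
  then have "f \<midarrow>0\<rightarrow> c"
    by (rule tendsto_eventually)
  then show ?thesis using assms(2) by (rule LIM_unique)
qed

text \<open>
  Along \<open>t *s x\<close> the two sides of \<open>p = a * F + b * G\<close> scale like \<open>t ^ d\<close> and like a multiple of
  \<open>t ^ 3\<close>, which tends to 0 after division by \<open>t ^ d\<close>.
\<close>
lemma homogeneous_in_ideal_of_cubics:
  assumes "p \<in> ideal_gen {F, G}" "homogeneous 3 F" "homogeneous 3 G" "homogeneous d p" "d < 3"
  shows "p = 0"
proof (rule mpoly_eq_zero_if_peval_zero)
  fix x
  obtain a b where p: "p = a * F + b * G"
    using ideal_gen_pairE[OF assms(1)] .
  let ?f = "\<lambda>t. t ^ (3 - d) * (peval a (t *s x) * peval F x + peval b (t *s x) * peval G x)"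
  have "?f t = peval p x" if "t \<noteq> 0" for t
  proof -
    have "t ^ d * peval p x = peval p (t *s x)"
      by (simp add: peval_scale_homogeneous[OF assms(4)])
    also have "\<dots> = t ^ (d + (3 - d)) * (peval a (t *s x) * peval F x + peval b (t *s x) * peval G x)"
      using \<open>d < 3\<close> by (simp add: p peval_scale_homogeneous[OF assms(2)]
          peval_scale_homogeneous[OF assms(3)] algebra_simps)
    also have "\<dots> = t ^ d * ?f t"
      by (simp only: power_add mult.assoc)
    finally show ?thesis using that by simp
  qed
  moreover have "?f \<midarrow>0\<rightarrow> 0 ^ (3 - d) * (peval a 0 * peval F x + peval b 0 * peval G x)"
    by (intro tendsto_intros tendsto_peval_scale)
  ultimately have "peval p x = 0 ^ (3 - d) * (peval a 0 * peval F x + peval b 0 * peval G x)"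
    by (rule eq_limit_at_0)
  then show "peval p x = 0" using \<open>d < 3\<close> by simp
qed

text \<open>
  A cubic form in the ideal is a member of the pencil: the same scaling argument shows that only the
  constant terms of the two coefficient polynomials matter.
\<close>
lemma cubic_in_ideal_of_cubics:
  assumes "p \<in> ideal_gen {F, G}" "homogeneous 3 F" "homogeneous 3 G" "homogeneous 3 p"
  obtains \<alpha> \<beta> where "\<And>x. peval p x = \<alpha> * peval F x + \<beta> * peval G x"
proof -
  obtain a b where p: "p = a * F + b * G"
    using ideal_gen_pairE[OF assms(1)] .
  have "peval p x = peval a 0 * peval F x + peval b 0 * peval G x" for x
  proof (rule eq_limit_at_0)
    fix t :: complex assume "t \<noteq> 0"
    have "t ^ 3 * (peval a (t *s x) * peval F x + peval b (t *s x) * peval G x) = peval p (t *s x)"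
      by (simp add: p peval_scale_homogeneous[OF assms(2)]
          peval_scale_homogeneous[OF assms(3)] algebra_simps)
    also have "\<dots> = t ^ 3 * peval p x"
      by (simp add: peval_scale_homogeneous[OF assms(4)])
    finally show "peval a (t *s x) * peval F x + peval b (t *s x) * peval G x = peval p x"
      using \<open>t \<noteq> 0\<close> by simp
  qed (intro tendsto_intros tendsto_peval_scale)
  then show ?thesis by (rule that)
qed

lemma dir_deriv_add: "dir_deriv (p + q) v w = dir_deriv p v w + dir_deriv q v w"
  by (simp add: dir_deriv_def pdiff_add ring_distribs sum.distrib)

lemma dir_deriv_mult:
  "dir_deriv (p * q) v w = peval p v * dir_deriv q v w + dir_deriv p v w * peval q v"
  by (simp add: dir_deriv_def peval_pdiff_mult ring_distribs sum.distrib
      sum_distrib_left sum_distrib_right ac_simps)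

text \<open>
  By Leibniz' rule, the polynomials that vanish to first order at \<open>v\<close> along \<open>w\<close> form an ideal.
\<close>
lemma dir_deriv_ideal_gen:
  assumes "p \<in> ideal_gen S" "\<And>s. s \<in> S \<Longrightarrow> peval s v = 0 \<and> dir_deriv s v w = 0"
  shows "peval p v = 0 \<and> dir_deriv p v w = 0"
proof -
  have "ideal.subspace {p. peval p v = 0 \<and> dir_deriv p v w = 0}"
    unfolding ideal.subspace_def by (auto simp: dir_deriv_add dir_deriv_mult)
      (simp add: dir_deriv_def pdiff_def)
  then show ?thesis
    using ideal.span_minimal[of S "{p. peval p v = 0 \<and> dir_deriv p v w = 0}"] assms by blast
qed

section \<open>Tangent cones\<close>

lemma lookup_initial_form:
  "Poly_Mapping.lookup (initial_form p) m =
    (if monom_degree m = Min (monom_degree ` Poly_Mapping.keys p)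
     then Poly_Mapping.lookup p m else 0)"
proof -
  let ?K = "{m \<in> Poly_Mapping.keys p. monom_degree m = Min (monom_degree ` Poly_Mapping.keys p)}"
  have "Poly_Mapping.lookup (initial_form p) m =
    (\<Sum>k\<in>?K. if k = m then Poly_Mapping.lookup p m else 0)"
    unfolding initial_form_def lookup_sum by (intro sum.cong) (auto simp: lookup_single when_def)
  then show ?thesis by (auto simp: in_keys_iff)
qed

lemma initial_form_homogeneous:
  assumes "homogeneous d p"
  shows "initial_form p = p"
proof (rule poly_mapping_eqI)
  fix m
  show "Poly_Mapping.lookup (initial_form p) m = Poly_Mapping.lookup p m"
  proof (cases "m \<in> Poly_Mapping.keys p")
    case True
    then have "monom_degree ` Poly_Mapping.keys p = {d}"
      using assms by (auto simp: homogeneous_def)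
    with True show ?thesis using assms by (auto simp: lookup_initial_form homogeneous_def)
  qed (auto simp: lookup_initial_form in_keys_iff)
qed

lemma dir_deriv_at_zero:
  "dir_deriv p 0 w = (\<Sum>j\<in>UNIV. w $ j * Poly_Mapping.lookup p (Poly_Mapping.single j 1))"
  by (simp add: dir_deriv_def peval_at_zero lookup_pdiff)

text \<open>
  Without constant term, the initial form has the same linear part as \<open>p\<close>, or none at all.
\<close>
lemma dir_deriv_initial_form:
  assumes "peval p 0 = 0" "dir_deriv p 0 w = 0"
  shows "peval (initial_form p) 0 = 0 \<and> dir_deriv (initial_form p) 0 w = 0"
  using assms by (cases "Min (monom_degree ` Poly_Mapping.keys p) = 1")
    (simp_all add: peval_at_zero dir_deriv_at_zero lookup_initial_form)

lemma peval_translate: "peval (psubst (\<lambda>j. Var j + Const (v $ j)) h) y = peval h (v + y)"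
proof -
  have "(\<chi> j. peval (Var j + Const (v $ j)) y) = v + y"
    by (simp add: vec_eq_iff)
  then show ?thesis by simp
qed

lemma dir_deriv_translate:
  "dir_deriv (psubst (\<lambda>j. Var j + Const (v $ j)) h) 0 w = dir_deriv h v w"
proof -
  have "peval (pdiff j (psubst (\<lambda>j. Var j + Const (v $ j)) h)) 0 = peval (pdiff j h) v" for j
    by (rule peval_pdiff_cong) (simp only: peval_translate add_0)
  then show ?thesis by (simp add: dir_deriv_def)
qed

text \<open>
  The tangent cone ideal has no linear forms beyond the differentials at \<open>v\<close>: a direction tangent
  to everything in \<open>I\<close> is annihilated by every linear part of the tangent cone ideal.
\<close>
lemma dir_deriv_tangent_cone_ideal:
  assumes "\<And>f. f \<in> I \<Longrightarrow> peval f v = 0 \<and> dir_deriv f v w = 0"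
    and "p \<in> tangent_cone_ideal I v"
  shows "dir_deriv p 0 w = 0"
proof -
  have "peval s 0 = 0 \<and> dir_deriv s 0 w = 0"
    if "s \<in> {initial_form (psubst (\<lambda>j. Var j + Const (v $ j)) h) |h. h \<in> I}" for s
    using that assms(1)
    by (auto intro!: dir_deriv_initial_form simp only: dir_deriv_translate peval_translate add_0_right)
  with assms(2) show ?thesis
    unfolding tangent_cone_ideal_def using dir_deriv_ideal_gen by blast
qed

abbreviation matrix_pullback :: "complex ^ 'm ^ 'n \<Rightarrow> 'n::finite mpoly \<Rightarrow> 'm::finite mpoly" where
  "matrix_pullback A \<equiv> psubst (\<lambda>i. \<Sum>j\<in>UNIV. Const (A $ i $ j) * Var j)"

lemma peval_matrix_pullback: "peval (matrix_pullback A p) z = peval p (A *v z)"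
proof -
  have "(\<chi> i. peval (\<Sum>j\<in>UNIV. Const (A $ i $ j) * Var j) z) = A *v z"
    by (simp add: vec_eq_iff matrix_vector_mult_def)
  then show ?thesis by simp
qed

text \<open>
  The Zariski tangent space lies in the linear span of the tangent cone. If \<open>B\<close> is a left inverse
  of \<open>A\<close>, the coordinates of \<open>x - A *v (B *v x)\<close> are linear forms that vanish on the range of \<open>A\<close>,
  so they lie in the ideal of the cone and must annihilate every tangent direction.
\<close>
lemma tangent_directions_in_range:
  fixes A :: "complex ^ 'm::finite ^ 'n::finite"
  assumes "inj ((*v) A)"
    and cone: "tangent_cone_ideal I v = {p. c dvd matrix_pullback A p}"
    and "\<And>f. f \<in> I \<Longrightarrow> peval f v = 0 \<and> dir_deriv f v w = 0"
  shows "w \<in> range ((*v) A)"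
proof -
  obtain B where B: "B ** A = mat 1"
    using assms(1) matrix_left_invertible_injective by blast
  have "w $ r = (A *v (B *v w)) $ r" for r
  proof -
    let ?l = "Var r - (\<Sum>j\<in>UNIV. Const ((A ** B) $ r $ j) * Var j)"
    have l: "peval ?l x = x $ r - (A *v (B *v x)) $ r" for x
      unfolding matrix_vector_mul_assoc by (simp add: matrix_vector_mult_def)
    have "matrix_pullback A ?l = 0"
    proof (rule mpoly_eq_zero_if_peval_zero)
      fix z
      have "B *v (A *v z) = z"
        unfolding matrix_vector_mul_assoc B by simp
      then show "peval (matrix_pullback A ?l) z = 0"
        unfolding peval_matrix_pullback l by simp
    qed
    then have "?l \<in> tangent_cone_ideal I v"
      unfolding cone by simp
    then have "dir_deriv ?l 0 w = 0"
      using dir_deriv_tangent_cone_ideal assms(3) by blast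
    moreover have "homogeneous 1 ?l"
      by (intro homogeneous_diff homogeneous_Var homogeneous_linear)
    ultimately have "peval ?l w = 0"
      by (subst peval_homogeneous_1) (auto simp: dir_deriv_def)
    then show ?thesis unfolding l by simp
  qed
  then have "w = A *v (B *v w)" by (simp add: vec_eq_iff)
  then show ?thesis by blast
qed

text \<open>
  A cubic cone with vertex \<open>v\<close> is its own initial form at \<open>v\<close>, so its pullback is divisible by
  \<open>c\<close>. Both sides being homogeneous of degree 3, the cofactor may be replaced by its value at 0. The
  factor \<open>k\<close> may still be zero.
\<close>
lemma cubic_restricted_to_tangent_cone:
  fixes A :: "complex ^ 'm::finite ^ 'n::finite"
  assumes cone: "tangent_cone_ideal I v = {p. c dvd matrix_pullback A p}"
    and "H \<in> I" "homogeneous 3 H" "homogeneous 3 c"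
    and vertex: "\<And>y. peval H (v + y) = peval H y"
  shows "\<exists>k. \<forall>z. peval H (A *v z) = k * peval c z"
proof -
  have "psubst (\<lambda>j. Var j + Const (v $ j)) H = H"
    by (rule mpoly_eqI) (simp only: peval_translate vertex)
  then have "H = initial_form (psubst (\<lambda>j. Var j + Const (v $ j)) H)"
    using initial_form_homogeneous[OF \<open>homogeneous 3 H\<close>] by simp
  then have "H \<in> tangent_cone_ideal I v"
    unfolding tangent_cone_ideal_def using \<open>H \<in> I\<close> by (intro ideal.span_base) blast
  then obtain d where d: "matrix_pullback A H = c * d"
    unfolding cone by (auto elim: dvdE)
  have Hd: "peval H (A *v z) = peval c z * peval d z" for z
    using arg_cong[OF d, of "\<lambda>q. peval q z"] by (simp only: peval_matrix_pullback peval_mult)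
  have "peval H (A *v z) = peval c z * peval d 0" for z
  proof (rule eq_limit_at_0)
    fix t :: complex assume "t \<noteq> 0"
    have "t ^ 3 * (peval c z * peval d (t *s z)) = peval H (A *v (t *s z))"
      unfolding Hd by (simp add: peval_scale_homogeneous[OF \<open>homogeneous 3 c\<close>])
    also have "\<dots> = t ^ 3 * peval H (A *v z)"
      by (simp add: vector_scalar_commute peval_scale_homogeneous[OF \<open>homogeneous 3 H\<close>])
    finally show "peval c z * peval d (t *s z) = peval H (A *v z)"
      using \<open>t \<noteq> 0\<close> by simp
  qed (intro tendsto_intros tendsto_peval_scale)
  then show ?thesis by (metis mult.commute)
qed

text \<open>
  The values are \<open>polar p u (s x) (t x)\<close>: the substitutions \<open>s\<close> and \<open>t\<close> are maps given by
  polynomials in the coordinates, which turns the bilinear form \<open>polar p u\<close> into a polynomial.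
\<close>
definition polar_form :: "'n::finite mpoly \<Rightarrow> complex ^ 'n \<Rightarrow> ('n \<Rightarrow> 'n mpoly) \<Rightarrow> ('n \<Rightarrow> 'n mpoly) \<Rightarrow> 'n mpoly"
  where "polar_form p u s t =
    (\<Sum>b\<in>UNIV. \<Sum>c\<in>UNIV. Const (polar p u (axis b 1) (axis c 1)) * (s b * t c))"

lemma polar_axis_expand:
  "polar p u v w = (\<Sum>b\<in>UNIV. \<Sum>c\<in>UNIV. polar p u (axis b 1) (axis c 1) * (v $ b * w $ c))"
proof -
  have "polar p u v w = (\<Sum>b\<in>UNIV. v $ b * polar p u (axis b 1) w)"
    using polar_sum_axis[of p u w v] by (simp add: polar_swap23)
  also have "\<dots> = (\<Sum>b\<in>UNIV. v $ b * (\<Sum>c\<in>UNIV. w $ c * polar p u (axis b 1) (axis c 1)))"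
    by (intro sum.cong refl arg_cong2[of _ _ _ _ "(*)"] polar_sum_axis)
  finally show ?thesis by (simp add: sum_distrib_left ac_simps)
qed

lemma peval_polar_form:
  "peval (polar_form p u s t) x = polar p u (\<chi> b. peval (s b) x) (\<chi> c. peval (t c) x)"
  by (subst polar_axis_expand) (simp add: polar_form_def, simp only: mult.assoc)

lemma homogeneous_polar_form:
  assumes "\<And>b. homogeneous 1 (s b)" "\<And>b. homogeneous 1 (t b)"
  shows "homogeneous 2 (polar_form p u s t)"
proof -
  have "homogeneous (0 + (1 + 1)) (polar_form p u s t)"
    unfolding polar_form_def
    by (intro homogeneous_sum homogeneous_mult homogeneous_Const assms)
  then show ?thesis by (simp add: numeral_2_eq_2)
qed

text \<open>
  A cubic form vanishing on the hyperplane of a linear form is that linear form times a quadratic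
  form, so the irreducible \<open>X\<close> lies in the zero locus of one of the two factors. But the ideal of
  \<open>X\<close> contains no nonzero forms of degree 1 or 2.
\<close>
lemma no_cubic_vanishing_on_hyperplane:
  fixes X :: "'n::finite ppoint set" and H :: "'n mpoly"
  assumes irr: "irreducible_closed X"
    and low: "\<And>p d. homogeneous d p \<Longrightarrow> d < 3 \<Longrightarrow> p \<in> vanishing_ideal X \<Longrightarrow> p = 0"
    and H: "homogeneous 3 H" "H \<noteq> 0" "H \<in> vanishing_ideal X"
    and "l j0 \<noteq> 0"
    and hyper: "\<And>x. (\<Sum>j\<in>UNIV. l j * x $ j) = 0 \<Longrightarrow> peval H x = 0"
  shows False
proof -
  let ?L = "\<Sum>j\<in>UNIV. Const (l j) * Var j"
  define u :: "complex ^ 'n" where "u = axis j0 (inverse (l j0))"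
  (* P is the projection along u onto the hyperplane L = 0. Replacing x by P x in one argument of
     polar H x x x after the other costs a multiple of L each time; Q collects the cofactors. *)
  define P where "P = (\<lambda>b. Var b - Const (u $ b) * ?L)"
  define Q where "Q = polar_form H u Var Var + polar_form H u Var P + polar_form H u P P"
  have L: "peval ?L x = (\<Sum>j\<in>UNIV. l j * x $ j)" for x
    by simp
  have "peval ?L u = (\<Sum>j\<in>UNIV. if j = j0 then 1 else 0)"
    unfolding L u_def using \<open>l j0 \<noteq> 0\<close> by (intro sum.cong) (auto simp: axis_def)
  then have Lu: "peval ?L u = 1" by simp
  have homL: "homogeneous 1 ?L" by (rule homogeneous_linear)
  have "homogeneous (0 + 1) (Const (u $ b) * ?L)" for b
    by (intro homogeneous_mult homogeneous_Const homL)
  then have "homogeneous 1 (P b)" for b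
    unfolding P_def by (intro homogeneous_diff homogeneous_Var) simp
  then have homQ: "homogeneous 2 Q"
    unfolding Q_def by (intro homogeneous_add homogeneous_polar_form homogeneous_Var)
  have LQ: "6 * peval H x = peval ?L x * peval Q x" for x
  proof -
    define x' where "x' = x - peval ?L x *s u"
    have Px: "(\<chi> b. peval (P b) x) = x'"
      by (simp add: vec_eq_iff P_def x'_def mult.commute)
    have Vx: "(\<chi> b. peval (Var b) x) = x"
      by (simp add: vec_eq_iff)
    have x: "x = x' + peval ?L x *s u" by (simp add: x'_def)
    have "peval ?L (a - k *s b) = peval ?L a - k * peval ?L b" for a b k
      unfolding L by (simp add: right_diff_distrib sum_subtractf sum_distrib_left ac_simps)
    then have "peval ?L x' = peval ?L x - peval ?L x * peval ?L u"
      unfolding x'_def .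
    then have "peval H x' = 0"
      using Lu hyper unfolding L by simp
    then have *: "polar H x' x' x' = 0"
      using polar_eq_peval[OF H(1)] by simp
    have "polar H x x x = polar H x' x x + peval ?L x * polar H u x x"
      using arg_cong[OF x, of "\<lambda>y. polar H y x x"] by (simp only: polar_add1 polar_scale1)
    moreover have "polar H x' x x = polar H x' x' x + peval ?L x * polar H x' u x"
      using arg_cong[OF x, of "\<lambda>y. polar H x' y x"] by (simp only: polar_add2 polar_scale2)
    moreover have "polar H x' x' x = peval ?L x * polar H x' x' u"
      using arg_cong[OF x, of "\<lambda>y. polar H x' x' y"]
      by (simp only: polar_add3 polar_scale3 * add_0)
    moreover have "polar H x' u x = polar H u x x'" "polar H x' x' u = polar H u x' x'"
      by (metis polar_swap12 polar_swap23)+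
    ultimately have "polar H x x x = peval ?L x * (polar H u x x + polar H u x x' + polar H u x' x')"
      by (simp only: distrib_left add.commute add.left_commute)
    moreover have "peval Q x = polar H u x x + polar H u x x' + polar H u x' x'"
      unfolding Q_def peval_add peval_polar_form Px Vx ..
    ultimately show ?thesis
      using polar_eq_peval[OF H(1)] by simp
  qed
  have "zariski_closed (zero_locus {?L})" "zariski_closed (zero_locus {Q})"
    unfolding zariski_closed_def using homL homQ by blast+
  moreover have "X \<subseteq> zero_locus {?L} \<union> zero_locus {Q}"
  proof
    fix Pt assume Pt: "Pt \<in> X"
    have "X \<subseteq> proj_space"
      using irr by (auto simp: irreducible_closed_def zariski_closed_def zero_locus_def)
    with Pt obtain x where x: "Pt = vec.span {x}" "Pt \<in> proj_space"
      by (auto simp: proj_space_def)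
    then have "x \<in> Pt" by (simp add: vec.span_base)
    then have "peval H x = 0"
      using H(3) Pt by (auto simp: vanishing_ideal_def)
    then have "peval ?L x * peval Q x = 0"
      unfolding LQ[symmetric] by simp
    then have "peval ?L x = 0 \<or> peval Q x = 0"
      by (simp only: mult_eq_0_iff)
    moreover have "peval q y = 0" if "homogeneous d q" "peval q x = 0" "y \<in> Pt" for q d y
      using that by (auto simp: x(1) vec.span_singleton peval_scale_homogeneous)
    ultimately have "(\<forall>y\<in>Pt. peval ?L y = 0) \<or> (\<forall>y\<in>Pt. peval Q y = 0)"
      using homL homQ by blast
    then show "Pt \<in> zero_locus {?L} \<union> zero_locus {Q}"
      using x(2) unfolding zero_locus_def by blast
  qed
  ultimately have "X \<subseteq> zero_locus {?L} \<or> X \<subseteq> zero_locus {Q}"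
    using irr unfolding irreducible_closed_def by blast
  then show False
  proof
    assume "X \<subseteq> zero_locus {?L}"
    then have "?L \<in> vanishing_ideal X"
      unfolding vanishing_ideal_def zero_locus_def by blast
    then have "?L = 0" using low[OF homL] by simp
    with Lu show False by (metis peval_zero zero_neq_one)
  next
    assume "X \<subseteq> zero_locus {Q}"
    then have "Q \<in> vanishing_ideal X"
      unfolding vanishing_ideal_def zero_locus_def by blast
    then have "Q = 0" using low[OF homQ] by simp
    then have "H = 0"
      using LQ by (intro mpoly_eq_zero_if_peval_zero) simp
    with H(2) show False ..
  qed
qed

text \<open>
  The range of \<open>A\<close> is spanned by its columns, whereas the hyperplane contains all but one of the
  coordinate vectors.
\<close>
lemma coordinate_hyperplane_not_in_range:
  fixes A :: "complex ^ 'm::finite ^ 'n::finite"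
  assumes "{w. w $ i = 0} \<subseteq> range ((*v) A)"
  shows "CARD('n) \<le> CARD('m) + 1"
proof -
  let ?B = "(\<lambda>j. axis j (1 :: complex)) ` (UNIV - {i})"
  have inj: "inj_on (\<lambda>j. axis j (1 :: complex)) (UNIV - {i})"
    by (auto simp: inj_on_def axis_eq_axis)
  have cols: "columns A = range (\<lambda>i. column i A)"
    by (auto simp: columns_def)
  have "?B \<subseteq> cart_basis"
    by (auto simp: cart_basis_def)
  then have indep: "vec.independent ?B"
    using independent_cart_basis vec.independent_mono by blast
  have "?B \<subseteq> range ((*v) A)"
    by (auto intro!: subsetD[OF assms] simp: axis_def)
  also have "range ((*v) A) \<subseteq> vec.span (columns A)"
    using matrix_vector_mult_in_columnspace_gen by blast
  finally have "?B \<subseteq> vec.span (columns A)" .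
  moreover have "finite (columns A)"
    unfolding cols by simp
  ultimately have "card ?B \<le> card (columns A)"
    using vec.independent_span_bound[OF _ indep] by blast
  moreover have "card (columns A) \<le> CARD('m)"
    unfolding cols by (rule card_image_le) simp
  ultimately show ?thesis
    by (simp add: card_image[OF inj])
qed

section \<open>Ordinary triple points as vertices\<close>

lemma span_singleton_eqI:
  fixes v x :: "complex ^ 'n"
  assumes "v \<in> vec.span {x}" "v \<noteq> 0"
  shows "vec.span {x} = vec.span {v}"
proof -
  obtain k where k: "v = k *s x"
    using assms(1) by (auto simp: vec.span_singleton)
  then have "k \<noteq> 0" using \<open>v \<noteq> 0\<close> by auto
  have "m *s x \<in> range (\<lambda>m. m *s v)" for m
    using \<open>k \<noteq> 0\<close> by (intro image_eqI[of _ _ "m / k"]) (auto simp: k)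
  then show ?thesis
    unfolding vec.span_singleton by (auto simp: k)
qed

text \<open>
  The smooth cubic surface whose cone is the tangent cone at \<open>v\<close> lives in a projective 3-space,
  embedded by \<open>A\<close>, and all tangent directions of \<open>X\<close> in the chart lie in the range of \<open>A\<close>. If the
  differentials of \<open>F\<close> and \<open>G\<close> at \<open>v\<close> were both zero, these directions would form the whole chart
  hyperplane, which is too large when there are more than 5 coordinates. A vertex of \<open>H\<close> in the
  tangent hyperplane, moved along \<open>v\<close> into the chart hyperplane, comes from a singular vector of
  the smooth form \<open>c\<close>, hence from 0.
\<close>
lemma ordinary_triple_point_of_pencil:
  fixes X :: "'n::finite ppoint set" and F G H :: "'n mpoly"
  assumes dim: "CARD('n) > 5"
    and irr: "irreducible_closed X"
    and F: "cubic_form F" and G: "cubic_form G" and ideal: "vanishing_ideal X = ideal_gen {F, G}"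
    and otp: "ordinary_triple_point X P"
    and H: "cubic_form H" "X \<subseteq> zero_locus {H}" "hypersurface_triple_point H P"
  shows "\<exists>v \<alpha> \<beta>. P = vec.span {v} \<and> transversal_vertex F G \<alpha> \<beta> v"
proof -
  have homs: "homogeneous 3 F" "homogeneous 3 G" "homogeneous 3 H" and "H \<noteq> 0"
    using F G H(1) by (auto simp: cubic_form_def)
  have "P \<in> X"
    using otp by (simp add: ordinary_triple_point_def isolated_singular_point_def singular_point_def)
  have Hvan: "H \<in> vanishing_ideal X"
    using H(2) unfolding vanishing_ideal_def zero_locus_def by blast
  then obtain \<alpha> \<beta> where comb: "\<And>x. peval H x = \<alpha> * peval F x + \<beta> * peval G x"
    using cubic_in_ideal_of_cubics homs unfolding ideal by metis
  have polH: "polar H x y z = \<alpha> * polar F x y z + \<beta> * polar G x y z" for x y z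
    by (rule polar_combination[OF homs comb])
  have ab: "(\<alpha>, \<beta>) \<noteq> (0, 0)"
    using comb \<open>H \<noteq> 0\<close> mpoly_eq_zero_if_peval_zero[of H] by auto
  obtain i v where v: "v \<in> P" "v $ i = 1"
    and "cone_over_smooth_cubic_surface (tangent_cone_ideal (chart_ideal X i) v)"
    using otp by (auto simp: ordinary_triple_point_def)
  then obtain A :: "complex ^ 4 ^ 'n" and c where A: "inj ((*v) A)"
    and c: "smooth_cubic_surface c"
    and cone: "tangent_cone_ideal (chart_ideal X i) v = {p. c dvd matrix_pullback A p}"
    unfolding cone_over_smooth_cubic_surface_def by blast
  have homc: "homogeneous 3 c"
    using c by (simp add: smooth_cubic_surface_def cubic_form_def)
  have "v \<noteq> 0" using v(2) by auto
  have P: "P = vec.span {v}"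
  proof -
    obtain x where x: "P = vec.span {x}"
      using H(3) by (auto simp: hypersurface_triple_point_def proj_space_def)
    then show ?thesis
      using v(1) span_singleton_eqI[OF _ \<open>v \<noteq> 0\<close>] by blast
  qed
  have Hv: "polar H v x y = 0" for x y
    using H(3) v(1) by (simp add: polar_eq_second_derivatives[OF homs(3)] hypersurface_triple_point_def)
  have "F \<in> vanishing_ideal X" "G \<in> vanishing_ideal X"
    unfolding ideal by (auto intro: ideal.span_base)
  then have FG0: "peval F v = 0" "peval G v = 0"
    using v(1) \<open>P \<in> X\<close> by (auto simp: vanishing_ideal_def)
  then have polv: "polar F v v v = 0" "polar G v v v = 0"
    by (simp_all add: polar_eq_peval[OF homs(1)] polar_eq_peval[OF homs(2)] FG0)
  (* Moving along v into the hyperplane w $ i = 0 does not change the conditions on F and G,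
     because both forms vanish at v; this normalization is used twice below. *)
  have tangent: "w \<in> range ((*v) A)"
    if w: "w $ i = 0" "polar F v v w = 0" "polar G v v w = 0" for w
  proof (rule tangent_directions_in_range[OF A cone])
    fix f assume f: "f \<in> chart_ideal X i"
    have "peval s v = 0 \<and> dir_deriv s v w = 0" if "s \<in> vanishing_ideal X" for s
    proof (rule dir_deriv_ideal_gen)
      show "s \<in> ideal_gen {F, G}" using that ideal by simp
      show "\<And>s. s \<in> {F, G} \<Longrightarrow> peval s v = 0 \<and> dir_deriv s v w = 0"
        using FG0 w polar_eq_dir_deriv[OF homs(1), of v w] polar_eq_dir_deriv[OF homs(2), of v w]
        by auto
    qed
    moreover have "peval (Var i - 1) v = 0 \<and> dir_deriv (Var i - 1) v w = 0"
    proof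
      show "peval (Var i - 1) v = 0" using v(2) by simp
      have "peval (pdiff j (Var i - 1)) v = (if j = i then 1 else 0)" for j
        by (rule peval_pdiff_unique) (auto simp: axis_def intro!: derivative_eq_intros)
      then have "dir_deriv (Var i - 1) v w = (\<Sum>j\<in>UNIV. if j = i then w $ i else 0)"
        unfolding dir_deriv_def by (intro sum.cong) auto
      then show "dir_deriv (Var i - 1) v w = 0" using w(1) by simp
    qed
    ultimately have "peval s v = 0 \<and> dir_deriv s v w = 0"
      if "s \<in> insert (Var i - 1) (vanishing_ideal X)" for s
      using that by blast
    then show "peval f v = 0 \<and> dir_deriv f v w = 0"
      using f unfolding chart_ideal_def by (rule dir_deriv_ideal_gen[rotated])
  qed
  have nonsing: "\<exists>w. polar F v v w \<noteq> 0 \<or> polar G v v w \<noteq> 0"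
  proof (rule ccontr)
    assume "\<not> ?thesis"
    then have "{w. w $ i = 0} \<subseteq> range ((*v) A)"
      using tangent by blast
    then show False
      using coordinate_hyperplane_not_in_range dim by force
  qed
  have "H \<in> chart_ideal X i"
    unfolding chart_ideal_def using Hvan by (intro ideal.span_base) simp
  moreover have "peval H (v + y) = peval H y" for y
  proof -
    have "polar H (v + y) (v + y) (v + y) = polar H y y y"
      by (simp add: polar_add1 polar_add2 polar_add3 Hv
          polar_swap12[of H y v] polar_swap23[of H y y v])
    then show ?thesis by (simp add: polar_eq_peval[OF homs(3)])
  qed
  ultimately obtain k where k: "\<And>z. peval H (A *v z) = k * peval c z"
    using cubic_restricted_to_tangent_cone[OF cone _ homs(3) homc] by blast
  (* If k = 0, then H vanishes on the tangent directions, and being a cone with vertex v it vanishes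
     on the whole tangent hyperplane, given by the linear form l below. *)
  have "k \<noteq> 0"
  proof
    assume "k = 0"
    obtain K where K: "K \<in> {F, G}"
      "\<And>w. polar K v v w = 0 \<Longrightarrow> polar F v v w = 0 \<and> polar G v v w = 0"
    proof (cases "\<beta> = 0")
      case True
      with ab have "polar F v v w = 0" for w using Hv polH by simp
      then show ?thesis using that[of G] by simp
    next
      case False
      have "polar G v v w = 0" if "polar F v v w = 0" for w
        using Hv[of v w] polH[of v v w] that False by simp
      then show ?thesis using that[of F] by simp
    qed
    define l where "l = (\<lambda>j. polar K v v (axis j 1))"
    have l: "polar K v v x = (\<Sum>j\<in>UNIV. l j * x $ j)" for x
      unfolding l_def by (subst polar_sum_axis) (simp add: mult.commute)
    obtain j0 where "l j0 \<noteq> 0"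
    proof (rule ccontr)
      assume "\<not> thesis"
      then have "\<And>j. l j = 0" using that by blast
      then have "polar K v v w = 0" for w unfolding l by simp
      with K(2) nonsing show False by blast
    qed
    show False
    proof (rule no_cubic_vanishing_on_hyperplane[where l = l and ?j0.0 = j0, OF irr _ homs(3) \<open>H \<noteq> 0\<close> Hvan \<open>l j0 \<noteq> 0\<close>])
      show "p = 0" if "homogeneous d p" "d < 3" "p \<in> vanishing_ideal X" for p d
        using homogeneous_in_ideal_of_cubics homs that unfolding ideal by blast
      fix x assume "(\<Sum>j\<in>UNIV. l j * x $ j) = 0"
      then have x: "polar F v v x = 0" "polar G v v x = 0"
        using K(2) by (auto simp: l)
      define w where "w = x - x $ i *s v"
      have "w \<in> range ((*v) A)"
        by (rule tangent) (simp_all add: w_def v(2) polar_diff3 polar_scale3 x polv)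
      then have "peval H w = 0" using k \<open>k = 0\<close> by auto
      moreover have "polar H w w w = polar H x x x"
        unfolding w_def by (simp add: polar_linear Hv polar_swap12[of H x v] polar_swap23[of H x x v])
      ultimately show "peval H x = 0" by (simp add: polar_eq_peval[OF homs(3)])
    qed
  qed
  have vertex: "\<exists>s. u = s *s v"
    if u: "\<And>x y. \<alpha> * polar F u x y + \<beta> * polar G u x y = 0"
      "polar F v v u = 0" "polar G v v u = 0" for u
  proof -
    define w where "w = u - u $ i *s v"
    have "w \<in> range ((*v) A)"
      by (rule tangent) (simp_all add: w_def v(2) polar_diff3 polar_scale3 u polv)
    then obtain z where z: "w = A *v z" by blast
    have "polar H w x y = 0" for x y
      using u(1) Hv unfolding w_def polar_diff1 polar_scale1 by (simp add: polH)
    moreover have "polar H (A *v z) (A *v z) (A *v z') = k * polar c z z z'" for z'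
      unfolding polarization[OF homs(3)] polarization[OF homc]
        matrix_vector_right_distrib[symmetric] k by (simp add: algebra_simps)
    ultimately have cz: "polar c z z z' = 0" for z'
      using \<open>k \<noteq> 0\<close> z by simp
    then have "gradient c z = 0"
      by (rule gradient_zero_if_polar_zero[OF homc])
    moreover have "peval c z = 0"
      using polar_eq_peval[OF homc, of z] cz by simp
    ultimately have "z = 0"
      using c unfolding smooth_cubic_surface_def by blast
    then have "u = u $ i *s v"
      using z by (simp add: w_def)
    then show ?thesis by blast
  qed
  have "transversal_vertex F G \<alpha> \<beta> v"
    unfolding transversal_vertex_def vertex_space_def
    using ab Hv polv nonsing vertex by (simp add: polH)
  with P show ?thesis by blast
qed

theorem theorem3p1:
  fixes X :: "6 ppoint set" and F G :: "6 mpoly"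
  assumes "threefold X"
    and "complete_intersection_of_cubics X F G"
    and "\<And>P. singular_point X P \<Longrightarrow> ordinary_triple_point X P"
    and "\<And>P. ordinary_triple_point X P \<Longrightarrow>
           \<exists>H. cubic_form H \<and> X \<subseteq> zero_locus {H} \<and> hypersurface_triple_point H P"
  shows "finite {P. ordinary_triple_point X P} \<and> card {P. ordinary_triple_point X P} \<le> 9"
proof (rule finite_if_finite_subsets_card_bdd)
  fix S assume S: "S \<subseteq> {P. ordinary_triple_point X P}" "finite S"
  have pencil: "cubic_form F" "cubic_form G" "vanishing_ideal X = ideal_gen {F, G}"
    using assms(2) by (simp_all add: complete_intersection_of_cubics_def)
  have irr: "irreducible_closed X"
    using assms(1) by (simp add: threefold_def)
  have "\<exists>v \<alpha> \<beta>. P = vec.span {v} \<and> transversal_vertex F G \<alpha> \<beta> v" if "P \<in> S" for P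
  proof -
    have otp: "ordinary_triple_point X P" using S(1) that by blast
    then obtain H where "cubic_form H" "X \<subseteq> zero_locus {H}" "hypersurface_triple_point H P"
      using assms(4) by blast
    then show ?thesis
      by (intro ordinary_triple_point_of_pencil[OF _ irr pencil otp]) simp_all
  qed
  then obtain v \<alpha> \<beta> where v: "\<And>P. P \<in> S \<Longrightarrow> P = vec.span {v P}"
    "\<And>P. P \<in> S \<Longrightarrow> transversal_vertex F G (\<alpha> P) (\<beta> P) (v P)"
    by metis
  have "P = Q" if PQ: "P \<in> S" "Q \<in> S" "v P = s *s v Q" for P Q s
  proof -
    have "v P \<in> vec.span {v Q}"
      unfolding PQ(3) by (simp add: vec.span_base vec.span_scale)
    then have "vec.span {v Q} = vec.span {v P}"
      by (rule span_singleton_eqI) (rule transversal_vertex_nonzero[OF v(2)[OF PQ(1)]])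
    then show ?thesis using v(1) PQ by metis
  qed
  then have "2 * card S \<le> 3 * CARD(6)"
    by (intro card_transversal_vertices[OF S(2) v(2)])
  then show "card S \<le> 9" by simp
qed

end
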